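(* Let $A$ be a real symmetric positive definite $n\times n$ matrix with energy decomposition $\mathcal{E}$, $\mathcal{V}$ an orthonormal basis of $\mathbb{R}^n$, $\mathcal{P}=\{P_j\}_{j=1}^M$ a partition of $\mathcal{V}$, and let $\Phi=[\Phi_1,\dots,\Phi_M]=[\varphi_1,\dots,\varphi_N]$, where the columns of $\Phi_j$ form an orthonormal basis of a subspace of $\mathrm{span}\{P_j\}$. Let $\Psi=[\psi_1,\dots,\psi_N]=A^{-1}\Phi(\Phi^TA^{-1}\Phi)^{-1}$. For each $i$ let $P_{j_i}$ be the patch such that $\varphi_i$ is a column of $\Phi_{j_i}$, and let $\psi_i^k$ be the $k$-local approximator of $\psi_i$. Then for each $i$ and each integer $k\ge0$, $$\|\psi_i^k-\psi_i\|_A^2\le\Big(\frac{\alpha(\mathcal{P})-1}{\alpha(\mathcal{P})}\Big)^k\|\psi_i^0-\psi_i\|_A^2\le\Big(\frac{\alpha(\mathcal{P})-1}{\alpha(\mathcal{P})}\Big)^k\delta(P_{j_i}).$$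
   Context: An energy decomposition of $A$ is a finite family $\mathcal{E}=\{E_k\}_{k=1}^m$ of symmetric positive semidefinite $n\times n$ matrices with $A=\sum_{k=1}^m E_k$. For $E\in\mathcal{E}$ and $u,v\in\mathcal{V}$ write $E\sim v$ if $v^TEv>0$, and $u\sim v$ if $u^TAv\ne0$. Let $\mathcal{N}(E;\mathcal{V})=\{v\in\mathcal{V}:E\sim v\}$. For $\mathcal{S}\subset\mathcal{V}$ write $E\sim\mathcal{S}$ if $\mathcal{N}(E;\mathcal{V})\cap\mathcal{S}\neq\emptyset$, and $E\in\mathcal{S}$ if $\mathcal{N}(E;\mathcal{V})\subset\mathcal{S}$. Let $P_{\mathcal{S}}$ be the Euclidean orthogonal projection onto $\mathrm{span}\{\mathcal{S}\}$. The interior energy of $\mathcal{S}$ is $\underline{A}_{\mathcal{S}}=\sum_{E\in\mathcal{S}}E$. The closed energy of $\mathcal{S}$ is $\overline{A}_{\mathcal{S}}=\sum_{E\in\mathcal{S}}E+\sum_{E\notin\mathcal{S},\,E\sim\mathcal{S}}P_{\mathcal{S}}E^{d}P_{\mathcal{S}}$, where $E^{d}=\sum_{v\in\mathcal{V}}\big(\sum_{u\in\mathcal{V}}|v^TEu|\big)vv^T$; it maps $\mathrm{span}\{\mathcal{S}\}$ to itself and is invertible there. A partition of $\mathcal{V}$ is a family of pairwise disjoint subsets $P_j\subset\mathcal{V}$ (patches) with union $\mathcal{V}$. Neighbor patch balls: $S_0(P_j)=P_j$ and $S_{k+1}(P_j)=\bigcup\{P_{j'}\in\mathcal{P}:P_{j'}\sim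 S_k(P_j)\}$, where $P_{j'}\sim\mathcal{S}$ means $u\sim v$ for some $u\in P_{j'}$, $v\in\mathcal{S}$. The $k$-local approximator $\psi_i^k$ is the minimizer of $\|x\|_A=\sqrt{x^TAx}$ over $x\in\mathrm{span}\{S_k(P_{j_i})\}$ subject to $\varphi_{i'}^Tx=\delta_{i',i}$ (Kronecker delta) for all $i'=1,\dots,N$. Condition factor: $\delta(P_j)=\max_{0\ne x\in\mathrm{span}(\Phi_j)}\frac{x^Tx}{x^T\overline{A}_{P_j}^{-1}x}$, where $\overline{A}_{P_j}^{-1}$ is the inverse of $\overline{A}_{P_j}$ as an operator on $\mathrm{span}\{P_j\}$. Let $U_j$ be the orthogonal complement of $\mathrm{span}(\Phi_j)$ in $\mathrm{span}\{P_j\}$. Define $\alpha(P_j)=\max_{0\ne x\in U_j}\frac{x^T\overline{A}_{P_j}x}{x^T\underline{A}_{P_j}x}$ and $\alpha(\mathcal{P})=\max_{j}\alpha(P_j)$. It is assumed that these ratios are well defined, i.e. $x^T\underline{A}_{P_j}x>0$ for all $0\ne x\in U_j$ and all $j$; if $U_j=\{0\}$, set $\alpha(P_j)=1$. (Always $\alpha(\mathcal{P})\ge1$; $0^0=1$.) *)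

theory Defs
  imports "HOL-Analysis.Analysis"
begin

(* Conventions.  The ambient space is real^'n.  Finite families are indexed by finite types:
   'e for the energies E_k, 'm for the patches P_j and 'q for the columns of Phi.
   An energy is always referred to by its index, so repeated energies count with multiplicity. *)

section \<open>Energy decompositions\<close>

definition symmetric_psd :: "real^'n^'n \<Rightarrow> bool" where
  "symmetric_psd E \<longleftrightarrow> transpose E = E \<and> (\<forall>x. 0 \<le> x \<bullet> (E *v x))"

definition symmetric_pd :: "real^'n^'n \<Rightarrow> bool" where
  "symmetric_pd A \<longleftrightarrow> transpose A = A \<and> (\<forall>x. x \<noteq> 0 \<longrightarrow> 0 < x \<bullet> (A *v x))"

definition energy_decomposition :: "real^'n^'n \<Rightarrow> ('e::finite \<Rightarrow> real^'n^'n) \<Rightarrow> bool" where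
  "energy_decomposition A E \<longleftrightarrow> (\<forall>k. symmetric_psd (E k)) \<and> A = (\<Sum>k\<in>UNIV. E k)"

definition orthonormal_basis :: "(real^'n) set \<Rightarrow> bool" where
  "orthonormal_basis V \<longleftrightarrow> pairwise orthogonal V \<and> (\<forall>v\<in>V. norm v = 1) \<and> span V = UNIV"

definition patch_partition :: "(real^'n) set \<Rightarrow> ('m::finite \<Rightarrow> (real^'n) set) \<Rightarrow> bool" where
  "patch_partition V P \<longleftrightarrow> disjoint_family P \<and> (\<Union>j. P j) = V"

definition energy_nbrs :: "real^'n^'n \<Rightarrow> (real^'n) set \<Rightarrow> (real^'n) set" where
  "energy_nbrs F V = {v \<in> V. 0 < v \<bullet> (F *v v)}"

definition energy_touches :: "(real^'n) set \<Rightarrow> real^'n^'n \<Rightarrow> (real^'n) set \<Rightarrow> bool" where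
  "energy_touches V F S \<longleftrightarrow> energy_nbrs F V \<inter> S \<noteq> {}"

definition energy_inside :: "(real^'n) set \<Rightarrow> real^'n^'n \<Rightarrow> (real^'n) set \<Rightarrow> bool" where
  "energy_inside V F S \<longleftrightarrow> energy_nbrs F V \<subseteq> S"

definition orth_projection :: "(real^'n) set \<Rightarrow> real^'n^'n" where
  "orth_projection S = matrix (\<lambda>x. THE y. y \<in> span S \<and> (\<forall>s\<in>span S. orthogonal (x - y) s))"

definition diag_energy :: "(real^'n) set \<Rightarrow> real^'n^'n \<Rightarrow> real^'n^'n" where
  "diag_energy V F =
     (\<Sum>v\<in>V. (\<Sum>u\<in>V. \<bar>v \<bullet> (F *v u)\<bar>) *\<^sub>R (columnvector v ** (rowvector v :: real^'n^1)))"

definition interior_energy ::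
  "('e::finite \<Rightarrow> real^'n^'n) \<Rightarrow> (real^'n) set \<Rightarrow> (real^'n) set \<Rightarrow> real^'n^'n" where
  "interior_energy E V S = (\<Sum>k | energy_inside V (E k) S. E k)"

definition closed_energy ::
  "('e::finite \<Rightarrow> real^'n^'n) \<Rightarrow> (real^'n) set \<Rightarrow> (real^'n) set \<Rightarrow> real^'n^'n" where
  "closed_energy E V S =
     (\<Sum>k | energy_inside V (E k) S. E k) +
     (\<Sum>k | \<not> energy_inside V (E k) S \<and> energy_touches V (E k) S.
        orth_projection S ** diag_energy V (E k) ** orth_projection S)"

section \<open>Patch balls and local approximators\<close>

definition vectors_adjacent :: "real^'n^'n \<Rightarrow> (real^'n) set \<Rightarrow> (real^'n) set \<Rightarrow> bool" where
  "vectors_adjacent A T S \<longleftrightarrow> (\<exists>u\<in>T. \<exists>v\<in>S. u \<bullet> (A *v v) \<noteq> 0)"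

primrec patch_ball ::
  "real^'n^'n \<Rightarrow> ('m::finite \<Rightarrow> (real^'n) set) \<Rightarrow> 'm \<Rightarrow> nat \<Rightarrow> (real^'n) set" where
  "patch_ball A P j 0 = P j"
| "patch_ball A P j (Suc k) = \<Union> {P j' | j'. vectors_adjacent A (P j') (patch_ball A P j k)}"

definition energy_norm :: "real^'n^'n \<Rightarrow> real^'n \<Rightarrow> real" where
  "energy_norm A x = sqrt (x \<bullet> (A *v x))"

definition Psi_matrix :: "real^'n^'n \<Rightarrow> real^'q^'n \<Rightarrow> real^'q^'n" where
  "Psi_matrix A \<Phi> = matrix_inv A ** \<Phi> ** matrix_inv (transpose \<Phi> ** matrix_inv A ** \<Phi>)"

(* The matrix Phi is given with a block map b: its i-th column belongs to the block Phi_(b i), so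
   b i is the patch index j_i. *)

definition block_columns :: "real^'q^'n \<Rightarrow> ('q \<Rightarrow> 'm) \<Rightarrow> 'm \<Rightarrow> (real^'n) set" where
  "block_columns \<Phi> b j = {column i \<Phi> | i. b i = j}"

definition patchwise_orthonormal ::
  "real^'q^'n \<Rightarrow> ('q \<Rightarrow> 'm) \<Rightarrow> ('m \<Rightarrow> (real^'n) set) \<Rightarrow> bool" where
  "patchwise_orthonormal \<Phi> b P \<longleftrightarrow>
     (\<forall>i. column i \<Phi> \<in> span (P (b i))) \<and>
     (\<forall>i i'. b i = b i' \<longrightarrow> column i \<Phi> \<bullet> column i' \<Phi> = (if i = i' then 1 else 0))"

definition local_approximator ::
  "real^'n^'n \<Rightarrow> ('m::finite \<Rightarrow> (real^'n) set) \<Rightarrow> real^'q^'n \<Rightarrow> ('q \<Rightarrow> 'm) \<Rightarrow> nat \<Rightarrow> 'q \<Rightarrow> real^'n" where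
  "local_approximator A P \<Phi> b k i =
     arg_min_on (energy_norm A)
       {x \<in> span (patch_ball A P (b i) k).
          \<forall>i'. column i' \<Phi> \<bullet> x = (if i' = i then 1 else 0)}"

section \<open>Condition factor and energy ratio\<close>

(* The maxima over x are written as suprema.  They are attained whenever the denominators are
   positive and x has a nonzero choice: the quotients are continuous and homogeneous of degree 0,
   so it suffices to look at the (compact) unit sphere of the subspace. *)

definition condition_factor ::
  "('e::finite \<Rightarrow> real^'n^'n) \<Rightarrow> (real^'n) set \<Rightarrow> ('m \<Rightarrow> (real^'n) set) \<Rightarrow>
     real^'q^'n \<Rightarrow> ('q \<Rightarrow> 'm) \<Rightarrow> 'm \<Rightarrow> real" where
  "condition_factor E V P \<Phi> b j =
     (SUP x \<in> span (block_columns \<Phi> b j) - {0}.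
        (x \<bullet> x) / (x \<bullet> the_inv_into (span (P j)) ((*v) (closed_energy E V (P j))) x))"

definition complement_space ::
  "('m \<Rightarrow> (real^'n) set) \<Rightarrow> real^'q^'n \<Rightarrow> ('q \<Rightarrow> 'm) \<Rightarrow> 'm \<Rightarrow> (real^'n) set" where
  "complement_space P \<Phi> b j = span (P j) \<inter> orthogonal_comp (span (block_columns \<Phi> b j))"

definition patch_ratio ::
  "('e::finite \<Rightarrow> real^'n^'n) \<Rightarrow> (real^'n) set \<Rightarrow> ('m \<Rightarrow> (real^'n) set) \<Rightarrow>
     real^'q^'n \<Rightarrow> ('q \<Rightarrow> 'm) \<Rightarrow> 'm \<Rightarrow> real" where
  "patch_ratio E V P \<Phi> b j =
     (if complement_space P \<Phi> b j = {0} then 1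
      else SUP x \<in> complement_space P \<Phi> b j - {0}.
             (x \<bullet> (closed_energy E V (P j) *v x)) / (x \<bullet> (interior_energy E V (P j) *v x)))"

definition partition_ratio ::
  "('e::finite \<Rightarrow> real^'n^'n) \<Rightarrow> (real^'n) set \<Rightarrow> ('m::finite \<Rightarrow> (real^'n) set) \<Rightarrow>
     real^'q^'n \<Rightarrow> ('q \<Rightarrow> 'm) \<Rightarrow> real" where
  "partition_ratio E V P \<Phi> b = Max (range (patch_ratio E V P \<Phi> b))"

end

theory Submission
  imports Defs
begin

text \<open>
  Call a vector annihilated by all columns of \<^term>\<open>\<Phi>\<close> a correction. The exact basis function \<open>\<psi>\<close>
  is feasible and energy-orthogonal to all corrections; the local approximator \<open>\<psi>\<^sup>k\<close> is feasible,
  supported on the ball \<open>S\<^sub>k\<close>, and energy-orthogonal to the corrections supported on \<open>S\<^sub>k\<close>. Hence the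
  error \<open>f = \<psi>\<^sup>k - \<psi>\<close> is itself a correction, and the next error \<open>g\<close> arises from \<open>f\<close> by subtracting
  its energy projection \<open>d\<close> to the corrections on \<open>S\<^sub>k\<^sub>+\<^sub>1\<close>.

  The residual \<open>A f\<close> vanishes on corrections inside \<open>S\<^sub>k\<close> by the minimality of \<open>\<psi>\<^sup>k\<close>, and on corrections
  outside \<open>S\<^sub>k\<^sub>+\<^sub>1\<close> because \<open>A\<close> does not couple \<open>S\<^sub>k\<close> to them and \<open>\<psi>\<close> is orthogonal to all corrections.
  Constraints are imposed patch by patch, so \<open>f\<close> may be cut along patches, and its energy equals
  \<open>f\<^sup>T A w\<close> for its part \<open>w\<close> on the layer between the two balls. This is \<open>d\<^sup>T A w\<close>, so the
  Cauchy-Schwarz inequality gives \<open>\<parallel>f\<parallel>\<^sup>2 \<le> \<parallel>d\<parallel> \<parallel>w\<parallel>\<close> in the energy norm. The comparison of energies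
  \<open>\<parallel>w\<parallel>\<^sup>2 \<le> \<Sum> closed \<le> \<alpha> \<Sum> interior \<le> \<alpha> \<parallel>f\<parallel>\<^sup>2\<close> (lemma \<open>restricted_energy_le\<close>) yields
  \<open>\<parallel>f\<parallel>\<^sup>2 \<le> \<alpha> \<parallel>d\<parallel>\<^sup>2\<close>, and the Pythagorean identity \<open>\<parallel>f\<parallel>\<^sup>2 = \<parallel>d\<parallel>\<^sup>2 + \<parallel>g\<parallel>\<^sup>2\<close> gives the
  contraction by \<open>(\<alpha> - 1) / \<alpha>\<close> in one step (lemma \<open>error_contraction\<close>).

  Two properties of the local energies carry the comparison. Interior energies of
  disjoint patches add up to at most the total energy, and closed energies add up to at least the total
  energy, because an energy that crosses patches is dominated by its diagonal majorant, which
  decouples the patches.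

  For the start, the error of \<open>\<psi>\<^sup>0\<close> is at most the energy of \<open>\<psi>\<^sup>0\<close>, hence at most that of any
  feasible vector on the patch; the one of least closed energy has energy at most the condition
  factor (lemma \<open>local_energy_le_condition_factor\<close>).
\<close>

section \<open>Quadratic forms of real matrices\<close>

lemma symmetric_inner_commute:
  fixes F :: "real^'n^'n"
  assumes "transpose F = F"
  shows "x \<bullet> (F *v y) = y \<bullet> (F *v x)"
  by (metis assms dot_lmul_matrix inner_commute vector_transpose_matrix)

lemma inner_transpose: "x \<bullet> (transpose M *v y) = (M *v x) \<bullet> y"
  for M :: "real^'q^'n"
  unfolding transpose_matrix_vector by (subst inner_commute, subst dot_lmul_matrix) (rule inner_commute)

lemma quadratic_form_add:
  fixes F :: "real^'n^'n"
  assumes "transpose F = F"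
  shows "(x + y) \<bullet> (F *v (x + y)) = x \<bullet> (F *v x) + 2 * (x \<bullet> (F *v y)) + y \<bullet> (F *v y)"
  using symmetric_inner_commute[OF assms, of x y]
  by (simp add: matrix_vector_right_distrib inner_simps)

text \<open>The usual discriminant argument in \<open>t\<close>. A form that is only semidefinite can vanish at \<open>y\<close>;
  then the polynomial is linear in \<open>t\<close> and nonnegativity forces its slope to be zero.\<close>

lemma psd_cauchy_schwarz:
  fixes F :: "real^'n^'n"
  assumes "symmetric_psd F"
  shows "(x \<bullet> (F *v y))\<^sup>2 \<le> (x \<bullet> (F *v x)) * (y \<bullet> (F *v y))"
proof -
  define a where "a = y \<bullet> (F *v y)"
  define c where "c = x \<bullet> (F *v y)"
  define d where "d = x \<bullet> (F *v x)"
  have nonneg: "0 \<le> d + 2 * t * c + t\<^sup>2 * a" for t :: real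
  proof -
    have "0 \<le> (x + t *\<^sub>R y) \<bullet> (F *v (x + t *\<^sub>R y))"
      using assms by (simp add: symmetric_psd_def)
    also have "\<dots> = d + 2 * t * c + t\<^sup>2 * a"
      using assms unfolding symmetric_psd_def a_def c_def d_def
      by (subst quadratic_form_add)
        (simp_all add: matrix_vector_mult_scaleR power2_eq_square algebra_simps)
    finally show ?thesis .
  qed
  have "c\<^sup>2 \<le> d * a"
  proof (cases "a = 0")
    case True
    have "c = 0"
    proof (rule ccontr)
      assume "c \<noteq> 0"
      then show False
        using nonneg[of "- (d + 1) / (2 * c)"] True by (simp add: field_simps)
    qed
    then show ?thesis using True by simp
  next
    case False
    then have "0 < a" using assms by (simp add: a_def symmetric_psd_def less_le)
    then show ?thesis
      using nonneg[of "- c / a"] by (simp add: power2_eq_square field_simps)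
  qed
  then show ?thesis by (simp add: a_def c_def d_def)
qed

lemma psd_isotropic_imp_kernel:
  fixes F :: "real^'n^'n"
  assumes "symmetric_psd F" and "x \<bullet> (F *v x) = 0"
  shows "F *v x = 0"
proof -
  have "((F *v x) \<bullet> (F *v x))\<^sup>2 \<le> 0"
    using psd_cauchy_schwarz[OF assms(1), of "F *v x" x] assms(2) by simp
  then show ?thesis by simp
qed

lemma pd_imp_psd: "symmetric_pd A \<Longrightarrow> symmetric_psd A"
  unfolding symmetric_pd_def symmetric_psd_def
  by (metis inner_zero_left less_eq_real_def)

lemma energy_norm_squared: "symmetric_psd A \<Longrightarrow> (energy_norm A x)\<^sup>2 = x \<bullet> (A *v x)"
  by (simp add: energy_norm_def symmetric_psd_def)

text \<open>The quotient is homogeneous of degree 0, so its values on the whole subspace are those on the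
  compact unit sphere. This makes the suprema that define the condition factor and the energy ratio
  into genuine upper bounds; without boundedness a real supremum carries no information.\<close>

lemma form_ratio_bdd_above:
  fixes F G :: "real^'n^'n"
  assumes U: "subspace U" and pos: "\<And>x. x \<in> U \<Longrightarrow> x \<noteq> 0 \<Longrightarrow> 0 < x \<bullet> (G *v x)"
  shows "bdd_above ((\<lambda>x. (x \<bullet> (F *v x)) / (x \<bullet> (G *v x))) ` (U - {0}))"
proof -
  define q where "q x = (x \<bullet> (F *v x)) / (x \<bullet> (G *v x))" for x
  have "compact (U \<inter> sphere 0 1)"
    using closed_subspace[OF U] by (intro closed_Int_compact) simp_all
  moreover have "continuous_on (U \<inter> sphere 0 1) q"
    unfolding q_def
  proof (intro continuous_intros ballI)
    fix x :: "real^'n" assume x: "x \<in> U \<inter> sphere 0 1"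
    then have "x \<noteq> 0" by auto
    with x show "x \<bullet> (G *v x) \<noteq> 0" using pos[of x] by simp
  qed
  ultimately have "bdd_above (q ` (U \<inter> sphere 0 1))"
    by (intro bounded_imp_bdd_above compact_imp_bounded compact_continuous_image)
  moreover have "q ` (U - {0}) \<subseteq> q ` (U \<inter> sphere 0 1)"
  proof (intro subsetI, elim imageE)
    fix y x assume y: "y = q x" and x: "x \<in> U - {0}"
    define u where "u = (1 / norm x) *\<^sub>R x"
    have "q u = q x"
      using x by (simp add: q_def u_def matrix_vector_mult_scaleR)
    moreover have "u \<in> U \<inter> sphere 0 1"
      using x U by (simp add: u_def subspace_scale)
    ultimately show "y \<in> q ` (U \<inter> sphere 0 1)" using y by (metis imageI)
  qed
  ultimately show ?thesis
    unfolding q_def by (rule bdd_above_mono)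
qed

text \<open>The forms below need not be definite on the whole space, so the projection comes from a
  dimension count: a subspace on which the form is positive meets the form-orthogonal complement
  only in zero.\<close>

lemma form_projection_exists:
  fixes F :: "real^'n^'n"
  assumes W: "subspace W" and pos: "\<And>w. w \<in> W \<Longrightarrow> w \<noteq> 0 \<Longrightarrow> 0 < w \<bullet> (F *v w)"
  obtains w where "w \<in> W" and "\<And>z. z \<in> W \<Longrightarrow> (y - w) \<bullet> (F *v z) = 0"
proof -
  define L where "L = (*v) F ` W"
  define K where "K = {r \<in> UNIV. \<forall>x\<in>L. orthogonal x r}"
  have L: "subspace L"
    unfolding L_def using W by (intro linear_subspace_image) simp
  have "inj_on ((*v) F) (span W)"
  proof (subst linear_inj_on_iff_eq_0)
    show "\<forall>v\<in>span W. F *v v = 0 \<longrightarrow> v = 0"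
      using pos W by (metis inner_zero_right less_irrefl span_eq_iff)
  qed simp_all
  then have dimL: "dim L = dim W"
    unfolding L_def by (intro dim_image_eq) simp_all
  have dimK: "dim K + dim L = DIM(real^'n)"
    using dim_subspace_orthogonal_to_vectors[OF L subspace_UNIV] by (simp add: K_def)
  have K: "subspace K"
    by (auto simp: K_def subspace_def orthogonal_def inner_simps)
  have "W \<inter> K = {0}"
  proof -
    have "w = 0" if "w \<in> W" "w \<in> K" for w
      using that pos[of w] by (force simp: K_def L_def orthogonal_def inner_commute)
    then show ?thesis using subspace_0[OF W] subspace_0[OF K] by auto
  qed
  then have "dim {x + y |x y. x \<in> W \<and> y \<in> K} = DIM(real^'n)"
    using dim_sums_Int[OF W K] dimK dimL by simp
  then have "span {x + y |x y. x \<in> W \<and> y \<in> K} = UNIV"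
    by (simp only: dim_eq_full)
  then have "{x + y |x y. x \<in> W \<and> y \<in> K} = UNIV"
    using subspace_sums[OF W K] by (simp only: span_eq_iff[THEN iffD2])
  then obtain w r where "y = w + r" "w \<in> W" "r \<in> K" by blast
  then show ?thesis
    by (intro that[of w]) (simp_all add: K_def L_def orthogonal_def inner_commute[of "F *v _"])
qed

lemma injective_matrix_inv:
  fixes A :: "real^'n^'n"
  assumes "\<And>x. A *v x = 0 \<Longrightarrow> x = 0"
  shows "A ** matrix_inv A = mat 1"
proof -
  have "invertible A"
    unfolding invertible_left_inverse matrix_left_invertible_ker using assms by blast
  then show ?thesis
    unfolding invertible_def matrix_inv_def by (rule someI2_ex) (rule conjunct1)
qed

text \<open>Applying \<open>A\<close> to a column \<open>\<psi>\<close> of \<^term>\<open>Psi_matrix A \<Phi>\<close> cancels the outer inverse, so \<open>A \<psi>\<close> is a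
  combination of the columns of \<^term>\<open>\<Phi>\<close>; the inner inverse normalises it to satisfy the
  constraints. Together the two properties determine \<open>\<psi>\<close>.\<close>

lemma Psi_column:
  fixes A :: "real^'n^'n" and \<Phi> :: "real^'q^'n"
  assumes pd: "symmetric_pd A" and indep: "\<And>c. \<Phi> *v c = 0 \<Longrightarrow> c = 0"
  shows "column i' \<Phi> \<bullet> column i (Psi_matrix A \<Phi>) = (if i' = i then 1 else 0)"
    and "(\<And>i'. column i' \<Phi> \<bullet> z = 0) \<Longrightarrow> column i (Psi_matrix A \<Phi>) \<bullet> (A *v z) = 0"
proof -
  define \<psi> where "\<psi> = column i (Psi_matrix A \<Phi>)"
  define H where "H = transpose \<Phi> ** matrix_inv A ** \<Phi>"
  have inv: "A ** matrix_inv A = mat 1"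
  proof (rule injective_matrix_inv)
    show "x = 0" if "A *v x = 0" for x
      using pd that unfolding symmetric_pd_def by (metis inner_zero_right less_irrefl)
  qed
  have kerH: "c = 0" if "H *v c = 0" for c
  proof -
    define z where "z = matrix_inv A *v (\<Phi> *v c)"
    have Az: "A *v z = \<Phi> *v c"
      by (simp add: z_def matrix_vector_mul_assoc inv matrix_mul_assoc)
    have "0 = c \<bullet> (H *v c)" using that by simp
    also have "\<dots> = c \<bullet> (transpose \<Phi> *v z)"
      by (simp add: H_def z_def matrix_vector_mul_assoc matrix_mul_assoc)
    also have "\<dots> = (\<Phi> *v c) \<bullet> z"
      by (rule inner_transpose)
    also have "\<dots> = z \<bullet> (A *v z)" by (simp add: Az inner_commute)
    finally have "z = 0" using pd by (force simp: symmetric_pd_def)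
    then show ?thesis using Az by (intro indep) simp
  qed
  have \<psi>: "\<psi> = matrix_inv A *v (\<Phi> *v (matrix_inv H *v axis i 1))"
    unfolding \<psi>_def
    by (simp add: matrix_vector_mult_basis[symmetric] Psi_matrix_def H_def matrix_vector_mul_assoc
        matrix_mul_assoc)
  have "transpose \<Phi> *v \<psi> = (H ** matrix_inv H) *v axis i 1"
    by (simp add: \<psi> matrix_vector_mul_assoc H_def matrix_mul_assoc)
  then have constr: "transpose \<Phi> *v \<psi> = axis i 1"
    using injective_matrix_inv[OF kerH] by simp
  show "column i' \<Phi> \<bullet> column i (Psi_matrix A \<Phi>) = (if i' = i then 1 else 0)"
  proof -
    have "column i' \<Phi> \<bullet> \<psi> = (transpose \<Phi> *v \<psi>) $ i'"
      by (simp add: matrix_vector_mul_component column_def transpose_def)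
    then show ?thesis unfolding constr by (simp add: axis_def \<psi>_def)
  qed
  have A\<psi>: "A *v \<psi> = \<Phi> *v (matrix_inv H *v axis i 1)"
    by (simp add: \<psi> matrix_vector_mul_assoc matrix_mul_assoc inv)
  assume "\<And>i'. column i' \<Phi> \<bullet> z = 0"
  then have "transpose \<Phi> *v z = 0"
    by (simp add: vec_eq_iff matrix_vector_mul_component column_def transpose_def)
  then have "(\<Phi> *v c) \<bullet> z = 0" for c
    using inner_transpose[of c \<Phi> z] by simp
  then have "z \<bullet> (A *v \<psi>) = 0" by (simp add: A\<psi> inner_commute)
  then show "column i (Psi_matrix A \<Phi>) \<bullet> (A *v z) = 0"
    using pd symmetric_inner_commute[of A \<psi> z] by (simp add: symmetric_pd_def \<psi>_def)
qed

section \<open>Coordinates in an orthonormal basis\<close>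

definition basis_part :: "(real^'n) set \<Rightarrow> real^'n \<Rightarrow> real^'n" where
  "basis_part S x = (\<Sum>v\<in>S. (v \<bullet> x) *\<^sub>R v)"

lemma basis_part_in_span: "basis_part S x \<in> span S"
  unfolding basis_part_def by (intro span_sum span_scale span_base)

lemma linear_basis_part: "linear (basis_part S)"
  unfolding basis_part_def
  by (intro linearI) (simp_all add: inner_simps algebra_simps sum.distrib scaleR_sum_right)

lemma orthonormal_basis_subset:
  assumes "orthonormal_basis V" and "S \<subseteq> V"
  shows "finite S" and "pairwise orthogonal S" and "\<And>v. v \<in> S \<Longrightarrow> norm v = 1"
proof -
  show *: "pairwise orthogonal S"
    using assms by (auto simp: orthonormal_basis_def intro: pairwise_subset)
  show **: "norm v = 1" if "v \<in> S" for v
    using assms that by (auto simp: orthonormal_basis_def)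
  show "finite S" by (rule pairwise_orthogonal_imp_finite[OF *])
qed

lemma basis_part_id:
  assumes "orthonormal_basis V" "S \<subseteq> V" "x \<in> span S"
  shows "basis_part S x = x"
  unfolding basis_part_def
  using orthonormal_basis_expand[of S x] orthonormal_basis_subset[OF assms(1,2)] assms(3)
  by (simp add: inner_commute)

lemma inner_basis_part:
  assumes "orthonormal_basis V" "S \<subseteq> V" "v \<in> V"
  shows "v \<bullet> basis_part S x = (if v \<in> S then v \<bullet> x else 0)"
proof -
  have "v \<bullet> u = (if v = u then 1 else 0)" if "u \<in> S" for u
    using that assms by (auto simp: orthonormal_basis_def pairwise_def orthogonal_def norm_eq_1)
  then have "v \<bullet> basis_part S x = (\<Sum>u\<in>S. (u \<bullet> x) * (if v = u then 1 else 0))"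
    unfolding basis_part_def by (simp add: inner_sum_right)
  also have "\<dots> = (\<Sum>u\<in>S. (if v = u then u \<bullet> x else 0))"
    by (intro sum.cong) auto
  finally show ?thesis
    using orthonormal_basis_subset(1)[OF assms(1,2)] by (simp add: sum.delta')
qed

lemma basis_part_basis_part:
  assumes "orthonormal_basis V" "S \<subseteq> V" "T \<subseteq> V"
  shows "basis_part S (basis_part T x) = basis_part (S \<inter> T) x"
proof -
  have fin: "finite S" by (rule orthonormal_basis_subset[OF assms(1,2)])
  have "basis_part S (basis_part T x) = (\<Sum>v\<in>S. if v \<in> T then (v \<bullet> x) *\<^sub>R v else 0)"
    unfolding basis_part_def[of S]
    using assms by (intro sum.cong) (auto simp: inner_basis_part)
  also have "\<dots> = basis_part (S \<inter> T) x"
    unfolding basis_part_def using fin by (subst sum.inter_restrict) auto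
  finally show ?thesis .
qed

lemma basis_part_disjoint_union:
  assumes "finite S" "finite T" "S \<inter> T = {}"
  shows "basis_part (S \<union> T) x = basis_part S x + basis_part T x"
  unfolding basis_part_def by (rule sum.union_disjoint[OF assms])

lemma basis_part_self_adjoint: "x \<bullet> basis_part S y = basis_part S x \<bullet> y"
  by (simp add: basis_part_def inner_sum_left inner_sum_right mult.commute inner_commute)

lemma in_span_iff_coordinates:
  assumes "orthonormal_basis V" "S \<subseteq> V"
  shows "x \<in> span S \<longleftrightarrow> (\<forall>v\<in>V - S. v \<bullet> x = 0)"
proof
  assume "x \<in> span S"
  then have "x = basis_part S x" using basis_part_id[OF assms] by simp
  then show "\<forall>v\<in>V - S. v \<bullet> x = 0"
    using inner_basis_part[OF assms, of _ x] by (metis DiffD1 DiffD2)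
next
  assume *: "\<forall>v\<in>V - S. v \<bullet> x = 0"
  have "x = basis_part V x"
    using basis_part_id[OF assms(1) order_refl] assms(1) by (simp add: orthonormal_basis_def)
  also have "\<dots> = basis_part S x"
    unfolding basis_part_def
    using * assms orthonormal_basis_subset(1)[OF assms(1) order_refl]
    by (intro sum.mono_neutral_right) auto
  finally show "x \<in> span S" by (metis basis_part_in_span)
qed

lemma orth_projection_eq_basis_part:
  assumes "orthonormal_basis V" "S \<subseteq> V"
  shows "orth_projection S *v x = basis_part S x"
proof -
  have residual: "orthogonal (x - basis_part S x) s" if "s \<in> span S" for x s
    using basis_part_id[OF assms that] basis_part_self_adjoint[of x S s]
    by (simp add: orthogonal_def inner_simps)
  have "(THE y. y \<in> span S \<and> (\<forall>s\<in>span S. orthogonal (x - y) s)) = basis_part S x" for x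
  proof (rule the_equality)
    show "basis_part S x \<in> span S \<and> (\<forall>s\<in>span S. orthogonal (x - basis_part S x) s)"
      by (simp add: residual basis_part_in_span)
  next
    fix y assume y: "y \<in> span S \<and> (\<forall>s\<in>span S. orthogonal (x - y) s)"
    define d where "d = y - basis_part S x"
    have "d \<in> span S" using y by (simp add: d_def basis_part_in_span span_diff)
    then have "orthogonal (x - y) d" "orthogonal (x - basis_part S x) d"
      using y residual by auto
    then have "d \<bullet> d = 0" by (simp add: d_def orthogonal_def inner_simps)
    then show "y = basis_part S x" by (simp add: d_def)
  qed
  then show ?thesis
    unfolding orth_projection_def by (simp add: matrix_works linear_basis_part)
qed

lemma rank_one_matrix_apply:
  "(columnvector v ** (rowvector v :: real^'n^1)) *v x = (v \<bullet> x) *\<^sub>R (v :: real^'n)"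
  by (simp add: vec_eq_iff matrix_vector_mult_def matrix_matrix_mult_def columnvector_def
      rowvector_def inner_vec_def sum_distrib_right sum_distrib_left mult_ac)

lemma sum_matrix_apply: "(\<Sum>k\<in>I. F k) *v x = (\<Sum>k\<in>I. F k *v (x :: real^'n))"
  for F :: "'i \<Rightarrow> real^'n^'m"
  by (induction I rule: infinite_finite_induct) (simp_all add: matrix_vector_mult_add_rdistrib)

lemma diag_energy_apply:
  "diag_energy V F *v x = (\<Sum>v\<in>V. ((\<Sum>u\<in>V. \<bar>v \<bullet> (F *v u)\<bar>) * (v \<bullet> x)) *\<^sub>R v)"
  unfolding diag_energy_def sum_matrix_apply
  by (simp add: scaleR_matrix_vector_assoc[symmetric] rank_one_matrix_apply)

lemma diag_energy_form:
  "x \<bullet> (diag_energy V F *v x) = (\<Sum>v\<in>V. (\<Sum>u\<in>V. \<bar>v \<bullet> (F *v u)\<bar>) * (v \<bullet> x)\<^sup>2)"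
  by (simp add: diag_energy_apply inner_sum_right power2_eq_square mult_ac inner_commute)

text \<open>Diagonal dominance: each off-diagonal term is split evenly between its row and its column by
  the inequality between the arithmetic and the geometric mean.\<close>

lemma form_le_diag_energy:
  fixes F :: "real^'n^'n"
  assumes V: "orthonormal_basis V" and F: "transpose F = F"
  shows "x \<bullet> (F *v x) \<le> x \<bullet> (diag_energy V F *v x)"
proof -
  define m where "m u v = \<bar>v \<bullet> (F *v u)\<bar>" for u v
  have m_commute: "m u v = m v u" for u v
    using symmetric_inner_commute[OF F] by (simp add: m_def)
  have x: "x = (\<Sum>v\<in>V. (v \<bullet> x) *\<^sub>R v)"
    using basis_part_id[OF V order_refl, of x] V by (simp add: orthonormal_basis_def basis_part_def)
  have "x \<bullet> (F *v x) = (\<Sum>u\<in>V. \<Sum>v\<in>V. (u \<bullet> x) * (v \<bullet> x) * (v \<bullet> (F *v u)))"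
    by (subst (1 2) x)
      (simp add: linear_sum[OF matrix_vector_mul_linear] inner_sum_left inner_sum_right
        matrix_vector_mult_scaleR sum_distrib_left mult_ac)
  also have "\<dots> \<le> (\<Sum>u\<in>V. \<Sum>v\<in>V. (m u v * (v \<bullet> x)\<^sup>2 + m v u * (u \<bullet> x)\<^sup>2) / 2)"
  proof (intro sum_mono)
    fix u v
    have "2 * ((u \<bullet> x) * (v \<bullet> x) * (v \<bullet> (F *v u))) \<le> m u v * (2 * \<bar>u \<bullet> x\<bar> * \<bar>v \<bullet> x\<bar>)"
    proof -
      have "(u \<bullet> x) * (v \<bullet> x) * (v \<bullet> (F *v u)) \<le> \<bar>(u \<bullet> x) * (v \<bullet> x) * (v \<bullet> (F *v u))\<bar>" by simp
      then show ?thesis by (simp add: m_def abs_mult mult_ac)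
    qed
    also have "\<dots> \<le> m u v * ((v \<bullet> x)\<^sup>2 + (u \<bullet> x)\<^sup>2)"
      using sum_squares_bound[of "\<bar>u \<bullet> x\<bar>" "\<bar>v \<bullet> x\<bar>"]
      by (intro mult_left_mono) (simp_all add: m_def)
    finally show "(u \<bullet> x) * (v \<bullet> x) * (v \<bullet> (F *v u))
        \<le> (m u v * (v \<bullet> x)\<^sup>2 + m v u * (u \<bullet> x)\<^sup>2) / 2"
      by (simp add: m_commute[of v u] distrib_left)
  qed
  also have "\<dots> = ((\<Sum>u\<in>V. \<Sum>v\<in>V. m u v * (v \<bullet> x)\<^sup>2) + (\<Sum>u\<in>V. \<Sum>v\<in>V. m v u * (u \<bullet> x)\<^sup>2)) / 2"
    by (simp add: sum.distrib sum_divide_distrib[symmetric])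
  also have "(\<Sum>u\<in>V. \<Sum>v\<in>V. m u v * (v \<bullet> x)\<^sup>2) = (\<Sum>u\<in>V. \<Sum>v\<in>V. m v u * (u \<bullet> x)\<^sup>2)"
    by (rule sum.swap)
  finally show ?thesis
    by (simp add: diag_energy_form m_def sum_distrib_right)
qed

section \<open>Local energies on the patches\<close>

locale energy_partition =
  fixes A :: "real^'n^'n"
    and E :: "'e::finite \<Rightarrow> real^'n^'n"
    and V :: "(real^'n) set"
    and P :: "'m::finite \<Rightarrow> (real^'n) set"
  assumes pd: "symmetric_pd A"
    and decomposition: "energy_decomposition A E"
    and basis: "orthonormal_basis V"
    and partition: "patch_partition V P"
begin

lemma energy_psd: "symmetric_psd (E k)"
  using decomposition by (simp add: energy_decomposition_def)

lemma energy_sym: "x \<bullet> (E k *v y) = y \<bullet> (E k *v x)"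
  using energy_psd by (intro symmetric_inner_commute) (simp add: symmetric_psd_def)

lemma energy_form_nonneg: "0 \<le> x \<bullet> (E k *v x)"
  using energy_psd by (simp add: symmetric_psd_def)

lemma energy_form_eq_sum: "x \<bullet> (A *v x) = (\<Sum>k\<in>UNIV. x \<bullet> (E k *v x))"
  using decomposition by (simp add: energy_decomposition_def sum_matrix_apply inner_sum_right)

lemma A_sym: "x \<bullet> (A *v y) = y \<bullet> (A *v x)"
  using pd by (intro symmetric_inner_commute) (simp add: symmetric_pd_def)

lemma A_nonneg: "0 \<le> x \<bullet> (A *v x)"
  using pd_imp_psd[OF pd] by (simp add: symmetric_psd_def)

lemma patch_subset: "P j \<subseteq> V"
  using partition by (auto simp: patch_partition_def)

lemma patch_disjoint: "i \<noteq> j \<Longrightarrow> P i \<inter> P j = {}"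
  using partition by (auto simp: patch_partition_def disjoint_family_on_def)

lemma patch_cover: "v \<in> V \<Longrightarrow> \<exists>j. v \<in> P j"
  using partition by (auto simp: patch_partition_def)

lemma finite_V: "finite V"
  by (rule orthonormal_basis_subset[OF basis order_refl])

lemma basis_part_V: "basis_part V x = x"
  using basis_part_id[OF basis order_refl] basis by (simp add: orthonormal_basis_def)

lemma basis_part_complement:
  assumes "S \<subseteq> V"
  shows "x = basis_part S x + basis_part (V - S) x"
proof -
  have "V = S \<union> (V - S)" using assms by blast
  then have "basis_part V x = basis_part S x + basis_part (V - S) x"
    using basis_part_disjoint_union[of S "V - S" x] assms finite_V finite_subset by fastforce
  then show ?thesis by (simp add: basis_part_V)
qed

lemma diag_energy_bilinear:
  "x \<bullet> (diag_energy V F *v y) = (\<Sum>v\<in>V. (\<Sum>u\<in>V. \<bar>v \<bullet> (F *v u)\<bar>) * (v \<bullet> x) * (v \<bullet> y))"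
  by (simp add: diag_energy_apply inner_sum_right inner_commute mult_ac)

lemma diag_energy_nonneg: "0 \<le> x \<bullet> (diag_energy V F *v x)"
  unfolding diag_energy_form by (intro sum_nonneg mult_nonneg_nonneg) simp_all

text \<open>Semidefiniteness turns the weak assumption \<open>v\<^sup>T E v = 0\<close> into \<open>E v = 0\<close>, so an energy inside
  a set sees only the coordinates in that set.\<close>

lemma energy_kills_non_neighbour:
  assumes "v \<in> V" "v \<notin> energy_nbrs (E k) V"
  shows "E k *v v = 0"
proof (rule psd_isotropic_imp_kernel[OF energy_psd])
  show "v \<bullet> (E k *v v) = 0"
    using assms energy_form_nonneg[of v k] by (auto simp: energy_nbrs_def)
qed

lemma energy_inside_apply:
  assumes "energy_inside V (E k) S" "S \<subseteq> V"
  shows "E k *v x = E k *v basis_part S x"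
proof -
  have "E k *v basis_part (V - S) x = (\<Sum>v\<in>V - S. (v \<bullet> x) *\<^sub>R (E k *v v))"
    by (simp add: basis_part_def linear_sum[OF matrix_vector_mul_linear] matrix_vector_mult_scaleR)
  also have "\<dots> = 0"
    using assms energy_kills_non_neighbour
    by (intro sum.neutral) (auto simp: energy_inside_def)
  finally have "E k *v basis_part (V - S) x = 0" .
  moreover have "E k *v x = E k *v basis_part S x + E k *v basis_part (V - S) x"
    using basis_part_complement[OF assms(2), of x] by (metis matrix_vector_right_distrib)
  ultimately show ?thesis by simp
qed

lemma energy_inside_form:
  assumes "energy_inside V (E k) S" "S \<subseteq> V"
  shows "x \<bullet> (E k *v x) = basis_part S x \<bullet> (E k *v basis_part S x)"
proof -
  show ?thesis
    using energy_inside_apply[OF assms, of x] energy_sym[of x k "basis_part S x"] by simp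
qed

lemma interior_energy_form:
  "x \<bullet> (interior_energy E V S *v x) = (\<Sum>k | energy_inside V (E k) S. x \<bullet> (E k *v x))"
  by (simp add: interior_energy_def sum_matrix_apply inner_sum_right)

lemma closed_energy_apply:
  assumes "S \<subseteq> V"
  shows "closed_energy E V S *v x = (\<Sum>k | energy_inside V (E k) S. E k *v x) +
    (\<Sum>k | \<not> energy_inside V (E k) S \<and> energy_touches V (E k) S.
      basis_part S (diag_energy V (E k) *v basis_part S x))"
  by (simp add: closed_energy_def matrix_vector_mult_add_rdistrib sum_matrix_apply
      matrix_vector_mul_assoc[symmetric] orth_projection_eq_basis_part[OF basis assms])

lemma closed_energy_bilinear:
  assumes "S \<subseteq> V"
  shows "x \<bullet> (closed_energy E V S *v y) = (\<Sum>k | energy_inside V (E k) S. x \<bullet> (E k *v y)) +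
    (\<Sum>k | \<not> energy_inside V (E k) S \<and> energy_touches V (E k) S.
      basis_part S x \<bullet> (diag_energy V (E k) *v basis_part S y))"
  by (simp add: closed_energy_apply[OF assms] inner_add_right inner_sum_right
      basis_part_self_adjoint)

lemma closed_energy_psd:
  assumes "S \<subseteq> V"
  shows "symmetric_psd (closed_energy E V S)"
proof -
  let ?C = "closed_energy E V S"
  have "x \<bullet> (?C *v y) = y \<bullet> (?C *v x)" for x y
  proof -
    have "x \<bullet> (E k *v y) = y \<bullet> (E k *v x)" for k by (rule energy_sym)
    then show ?thesis
      by (simp add: closed_energy_bilinear[OF assms] diag_energy_bilinear mult_ac)
  qed
  then have "x \<bullet> (transpose ?C *v y) = x \<bullet> (?C *v y)" for x y
    by (simp only: inner_transpose) (simp only: inner_commute)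
  then have "transpose ?C *v y = ?C *v y" for y
    by (intro vector_eq_ldot[THEN iffD1]) blast
  then have "transpose ?C = ?C" unfolding matrix_eq by blast
  moreover have "0 \<le> x \<bullet> (?C *v x)" for x
    unfolding closed_energy_bilinear[OF assms]
    by (intro add_nonneg_nonneg sum_nonneg) (simp_all add: energy_form_nonneg diag_energy_nonneg)
  ultimately show ?thesis by (simp add: symmetric_psd_def)
qed

lemma closed_energy_sym:
  "x \<bullet> (closed_energy E V (P j) *v y) = y \<bullet> (closed_energy E V (P j) *v x)"
  using closed_energy_psd[OF patch_subset]
  by (intro symmetric_inner_commute) (simp add: symmetric_psd_def)

lemma closed_energy_range:
  assumes "S \<subseteq> V"
  shows "closed_energy E V S *v x \<in> span S"
proof -
  have "E k *v x \<in> span S" if inside: "energy_inside V (E k) S" for k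
  proof (subst in_span_iff_coordinates[OF basis assms], rule ballI)
    fix v assume "v \<in> V - S"
    then have "E k *v v = 0"
      using inside energy_kills_non_neighbour by (auto simp: energy_inside_def)
    moreover have "v \<bullet> (E k *v x) = x \<bullet> (E k *v v)" by (rule energy_sym)
    ultimately show "v \<bullet> (E k *v x) = 0" by simp
  qed
  then show ?thesis
    unfolding closed_energy_apply[OF assms]
    by (intro span_add span_sum basis_part_in_span) simp
qed

text \<open>The two energies differ by the diagonal terms of the crossing energies, which are
  nonnegative. This is what makes the energy ratio at least 1.\<close>

lemma interior_le_closed:
  assumes "S \<subseteq> V"
  shows "x \<bullet> (interior_energy E V S *v x) \<le> x \<bullet> (closed_energy E V S *v x)"
  unfolding closed_energy_bilinear[OF assms] interior_energy_form
  using sum_nonneg[of _ "\<lambda>k. basis_part S x \<bullet> (diag_energy V (E k) *v basis_part S x)"]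
  by (simp add: diag_energy_nonneg)

text \<open>The share of one energy in the closed energy of \<open>S\<close>. Summing the shares over all patches for a
  fixed energy, and only then over the energies, gives the global comparison below.\<close>

definition local_closed_term :: "(real^'n) set \<Rightarrow> 'e \<Rightarrow> real^'n \<Rightarrow> real" where
  "local_closed_term S k y =
     (if energy_inside V (E k) S then y \<bullet> (E k *v y)
      else if energy_touches V (E k) S then y \<bullet> (diag_energy V (E k) *v y) else 0)"

lemma local_closed_term_nonneg: "0 \<le> local_closed_term S k y"
  by (simp add: local_closed_term_def energy_form_nonneg diag_energy_nonneg)

lemma closed_energy_form_eq_sum:
  assumes "S \<subseteq> V" "y \<in> span S"
  shows "y \<bullet> (closed_energy E V S *v y) = (\<Sum>k\<in>UNIV. local_closed_term S k y)"
proof -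
  let ?I = "{k. energy_inside V (E k) S}"
  let ?T = "{k. \<not> energy_inside V (E k) S \<and> energy_touches V (E k) S}"
  have "(\<Sum>k\<in>UNIV. local_closed_term S k y) = (\<Sum>k\<in>?I \<union> ?T. local_closed_term S k y)"
    by (intro sum.mono_neutral_right) (auto simp: local_closed_term_def)
  also have "\<dots> = (\<Sum>k\<in>?I. local_closed_term S k y) + (\<Sum>k\<in>?T. local_closed_term S k y)"
    by (intro sum.union_disjoint) auto
  also have "\<dots> = y \<bullet> (closed_energy E V S *v y)"
    by (simp add: closed_energy_bilinear[OF assms(1)] local_closed_term_def
        basis_part_id[OF basis assms])
  finally show ?thesis by simp
qed

text \<open>An energy inside some patch is reproduced exactly by that patch. A crossing energy is first
  replaced by its diagonal majorant, which splits along the patches because it is diagonal in the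
  basis; the patches that it does not touch contribute nothing, since the corresponding rows vanish.\<close>

lemma energy_le_local_closed_terms:
  "x \<bullet> (E k *v x) \<le> (\<Sum>j\<in>UNIV. local_closed_term (P j) k (basis_part (P j) x))"
proof (cases "\<exists>j. energy_inside V (E k) (P j)")
  case True
  then obtain j where j: "energy_inside V (E k) (P j)" by blast
  then have "x \<bullet> (E k *v x) = local_closed_term (P j) k (basis_part (P j) x)"
    using energy_inside_form[OF j patch_subset] by (simp add: local_closed_term_def)
  also have "\<dots> \<le> (\<Sum>j\<in>UNIV. local_closed_term (P j) k (basis_part (P j) x))"
    by (intro member_le_sum) (simp_all add: local_closed_term_nonneg)
  finally show ?thesis .
next
  case False
  define d where "d v = (\<Sum>u\<in>V. \<bar>v \<bullet> (E k *v u)\<bar>)" for v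
  have "x \<bullet> (E k *v x) \<le> x \<bullet> (diag_energy V (E k) *v x)"
    using energy_psd by (intro form_le_diag_energy basis) (simp add: symmetric_psd_def)
  also have "\<dots> = (\<Sum>v\<in>(\<Union>j. P j). d v * (v \<bullet> x)\<^sup>2)"
    using partition by (simp add: diag_energy_form d_def patch_partition_def)
  also have "\<dots> = (\<Sum>j\<in>UNIV. \<Sum>v\<in>P j. d v * (v \<bullet> x)\<^sup>2)"
    using patch_disjoint finite_subset[OF patch_subset finite_V]
    by (intro sum.UNION_disjoint) auto
  also have "\<dots> = (\<Sum>j\<in>UNIV. local_closed_term (P j) k (basis_part (P j) x))"
  proof (intro sum.cong refl)
    fix j
    have restrict: "basis_part (P j) x \<bullet> (diag_energy V (E k) *v basis_part (P j) x)
        = (\<Sum>v\<in>P j. d v * (v \<bullet> x)\<^sup>2)"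
    proof -
      have "basis_part (P j) x \<bullet> (diag_energy V (E k) *v basis_part (P j) x)
          = (\<Sum>v\<in>V. if v \<in> P j then d v * (v \<bullet> x)\<^sup>2 else 0)"
        unfolding diag_energy_form d_def
        by (intro sum.cong) (simp_all add: inner_basis_part[OF basis patch_subset])
      also have "\<dots> = (\<Sum>v\<in>V \<inter> P j. d v * (v \<bullet> x)\<^sup>2)"
        using finite_V by (simp add: sum.inter_restrict)
      finally show ?thesis using patch_subset[of j] by (simp add: Int_absorb1)
    qed
    show "(\<Sum>v\<in>P j. d v * (v \<bullet> x)\<^sup>2) = local_closed_term (P j) k (basis_part (P j) x)"
    proof (cases "energy_touches V (E k) (P j)")
      case True
      then show ?thesis using False restrict by (simp add: local_closed_term_def)
    next
      case untouched: False
      have "d v = 0" if "v \<in> P j" for v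
      proof -
        have "v \<in> V" using that patch_subset by blast
        then have "E k *v v = 0"
          using that untouched by (intro energy_kills_non_neighbour) (auto simp: energy_touches_def)
        moreover have "v \<bullet> (E k *v u) = u \<bullet> (E k *v v)" for u by (rule energy_sym)
        ultimately show ?thesis by (simp add: d_def)
      qed
      then show ?thesis using False untouched by (simp add: local_closed_term_def)
    qed
  qed
  finally show ?thesis .
qed

lemma energy_le_closed_sum:
  "x \<bullet> (A *v x) \<le>
    (\<Sum>j\<in>UNIV. basis_part (P j) x \<bullet> (closed_energy E V (P j) *v basis_part (P j) x))"
proof -
  have "x \<bullet> (A *v x) \<le> (\<Sum>k\<in>UNIV. \<Sum>j\<in>UNIV. local_closed_term (P j) k (basis_part (P j) x))"
    unfolding energy_form_eq_sum by (intro sum_mono energy_le_local_closed_terms)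
  also have "\<dots> = (\<Sum>j\<in>UNIV. \<Sum>k\<in>UNIV. local_closed_term (P j) k (basis_part (P j) x))"
    by (rule sum.swap)
  finally show ?thesis
    by (simp add: closed_energy_form_eq_sum[OF patch_subset basis_part_in_span])
qed

lemma energy_le_closed:
  assumes "x \<in> span (P j)"
  shows "x \<bullet> (A *v x) \<le> x \<bullet> (closed_energy E V (P j) *v x)"
proof -
  have self: "basis_part (P j) x = x"
    by (rule basis_part_id[OF basis patch_subset assms])
  have other: "basis_part (P l) x = 0" if "l \<noteq> j" for l
    using basis_part_basis_part[OF basis patch_subset patch_subset, of l j x]
      patch_disjoint[OF that] self by (simp add: basis_part_def)
  have "(\<Sum>l\<in>UNIV. basis_part (P l) x \<bullet> (closed_energy E V (P l) *v basis_part (P l) x))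
      = (\<Sum>l\<in>UNIV. if l = j then x \<bullet> (closed_energy E V (P j) *v x) else 0)"
    by (intro sum.cong) (simp_all add: self other)
  then show ?thesis using energy_le_closed_sum[of x] by simp
qed

text \<open>Patches are disjoint, so a nonzero energy lies inside at most one of them, and then it
  is counted with its exact value. An energy with no neighbours lies inside every patch, but it is
  the zero matrix.\<close>

lemma interior_sum_le_energy:
  "(\<Sum>j\<in>UNIV. basis_part (P j) x \<bullet> (interior_energy E V (P j) *v basis_part (P j) x))
    \<le> x \<bullet> (A *v x)"
proof -
  have "(\<Sum>j\<in>UNIV. basis_part (P j) x \<bullet> (interior_energy E V (P j) *v basis_part (P j) x))
      = (\<Sum>j\<in>UNIV. \<Sum>k\<in>UNIV. if energy_inside V (E k) (P j) then x \<bullet> (E k *v x) else 0)"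
  proof (intro sum.cong refl)
    fix j
    have "basis_part (P j) x \<bullet> (interior_energy E V (P j) *v basis_part (P j) x)
        = (\<Sum>k | k \<in> UNIV \<and> energy_inside V (E k) (P j). x \<bullet> (E k *v x))"
      unfolding interior_energy_form
      by (intro sum.cong) (simp_all add: energy_inside_form[OF _ patch_subset, of _ _ x])
    then show "basis_part (P j) x \<bullet> (interior_energy E V (P j) *v basis_part (P j) x)
        = (\<Sum>k\<in>UNIV. if energy_inside V (E k) (P j) then x \<bullet> (E k *v x) else 0)"
      by (simp only: sum.inter_filter[OF finite])
  qed
  also have "\<dots> = (\<Sum>k\<in>UNIV. \<Sum>j\<in>UNIV. if energy_inside V (E k) (P j) then x \<bullet> (E k *v x) else 0)"
    by (rule sum.swap)
  also have "\<dots> \<le> (\<Sum>k\<in>UNIV. x \<bullet> (E k *v x))"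
  proof (intro sum_mono)
    fix k
    show "(\<Sum>j\<in>UNIV. if energy_inside V (E k) (P j) then x \<bullet> (E k *v x) else 0) \<le> x \<bullet> (E k *v x)"
    proof (cases "energy_nbrs (E k) V = {}")
      case True
      then have "E k *v x = 0"
        using energy_inside_apply[of k "{}" x] by (simp add: energy_inside_def basis_part_def)
      then show ?thesis by (simp cong: if_cong)
    next
      case False
      then have unique: "i = j" if "energy_inside V (E k) (P i)" "energy_inside V (E k) (P j)" for i j
        using that patch_disjoint[of i j] by (fastforce simp: energy_inside_def)
      show ?thesis
      proof (cases "\<exists>j. energy_inside V (E k) (P j)")
        case True
        then obtain i where i: "energy_inside V (E k) (P i)" by blast
        have "(\<Sum>j\<in>UNIV. if energy_inside V (E k) (P j) then x \<bullet> (E k *v x) else 0)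
            = (\<Sum>j\<in>UNIV. if j = i then x \<bullet> (E k *v x) else 0)"
          using i unique by (intro sum.cong) auto
        then show ?thesis by simp
      next
        case False
        then show ?thesis by (simp add: energy_form_nonneg)
      qed
    qed
  qed
  finally show ?thesis by (simp add: energy_form_eq_sum)
qed

lemma closed_energy_positive:
  assumes "x \<in> span (P j)" "x \<noteq> 0"
  shows "0 < x \<bullet> (closed_energy E V (P j) *v x)"
proof -
  have "0 < x \<bullet> (A *v x)" using pd assms(2) by (simp add: symmetric_pd_def)
  also have "\<dots> \<le> x \<bullet> (closed_energy E V (P j) *v x)" by (rule energy_le_closed[OF assms(1)])
  finally show ?thesis .
qed

text \<open>The closed energy is positive on the span of the patch and maps it into itself; an injective
  endomorphism of a finite-dimensional space is onto. Hence the inverse in the condition factor is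
  the true inverse on the span.\<close>

lemma closed_energy_inverse:
  assumes "y \<in> span (P j)"
  defines "x \<equiv> the_inv_into (span (P j)) ((*v) (closed_energy E V (P j))) y"
  shows "x \<in> span (P j)" and "closed_energy E V (P j) *v x = y"
proof -
  let ?C = "(*v) (closed_energy E V (P j))"
  have inj: "inj_on ?C (span (P j))"
  proof (subst linear_inj_on_iff_eq_0)
    show "\<forall>x\<in>span (P j). closed_energy E V (P j) *v x = 0 \<longrightarrow> x = 0"
      using closed_energy_positive by fastforce
  qed simp_all
  have "dim (?C ` span (P j)) = dim (span (P j))"
    using inj by (intro dim_image_eq) (simp_all add: span_span)
  moreover have "?C ` span (P j) \<subseteq> span (P j)"
    using closed_energy_range[OF patch_subset] by blast
  ultimately have onto: "?C ` span (P j) = span (P j)"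
    by (intro subspace_dim_equal linear_subspace_image) simp_all
  show "x \<in> span (P j)"
    unfolding x_def using assms(1) onto by (intro the_inv_into_into[OF inj]) auto
  show "closed_energy E V (P j) *v x = y"
    unfolding x_def using assms(1) onto by (intro f_the_inv_into_f[OF inj]) auto
qed

section \<open>Patch balls\<close>

text \<open>The sets along which a vector that every column annihilates may be cut without losing this
  property. The alternative between containment and disjointness leaves room for empty patches.\<close>

definition patch_union :: "(real^'n) set \<Rightarrow> bool" where
  "patch_union S \<longleftrightarrow> S \<subseteq> V \<and> (\<forall>j. P j \<subseteq> S \<or> P j \<inter> S = {})"

lemma patch_union_Union: "patch_union (\<Union>j\<in>J. P j)"
proof -
  have "P j \<subseteq> (\<Union>j\<in>J. P j) \<or> P j \<inter> (\<Union>j\<in>J. P j) = {}" for j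
  proof (cases "j \<in> J")
    case False
    then have "P j \<inter> P l = {}" if "l \<in> J" for l using that by (intro patch_disjoint) auto
    then show ?thesis by blast
  qed blast
  then show ?thesis unfolding patch_union_def using patch_subset by blast
qed

lemma patch_union_Diff: "patch_union S \<Longrightarrow> patch_union T \<Longrightarrow> patch_union (S - T)"
  unfolding patch_union_def by blast

lemma patch_union_V: "patch_union V"
  using patch_subset by (auto simp: patch_union_def)

lemma patch_ball_patch_union: "patch_union (patch_ball A P j k)"
proof (cases k)
  case 0
  then show ?thesis using patch_union_Union[of "{j}"] by simp
next
  case (Suc l)
  have "patch_ball A P j k = (\<Union>j'\<in>{j'. vectors_adjacent A (P j') (patch_ball A P j l)}. P j')"
    using Suc by auto
  then show ?thesis by (simp only: patch_union_Union)
qed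

text \<open>The ball grows because each of its basis vectors is adjacent to itself, by positive
  definiteness.\<close>

lemma patch_ball_Suc_subset: "patch_ball A P j k \<subseteq> patch_ball A P j (Suc k)"
proof
  fix v assume v: "v \<in> patch_ball A P j k"
  then have "v \<in> V" using patch_ball_patch_union by (auto simp: patch_union_def)
  then obtain j' where j': "v \<in> P j'" using patch_cover by blast
  have "v \<noteq> 0" using \<open>v \<in> V\<close> basis by (auto simp: orthonormal_basis_def)
  then have "v \<bullet> (A *v v) \<noteq> 0" using pd by (simp add: symmetric_pd_def less_imp_neq[symmetric])
  then have "vectors_adjacent A (P j') (patch_ball A P j k)"
    using v j' by (auto simp: vectors_adjacent_def)
  then show "v \<in> patch_ball A P j (Suc k)" using j' by auto
qed

lemma patch_subset_patch_ball: "P j \<subseteq> patch_ball A P j k"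
proof (induction k)
  case (Suc k)
  then show ?case using patch_ball_Suc_subset by blast
qed simp

lemma patch_ball_Suc_separates:
  assumes x: "x \<in> span (patch_ball A P j k)" and z: "z \<in> span (V - patch_ball A P j (Suc k))"
  shows "x \<bullet> (A *v z) = 0"
proof -
  have gen: "v \<bullet> (A *v u) = 0"
    if v: "v \<in> V - patch_ball A P j (Suc k)" and u: "u \<in> patch_ball A P j k" for u v
  proof (rule ccontr)
    assume "v \<bullet> (A *v u) \<noteq> 0"
    moreover obtain j' where "v \<in> P j'" using v patch_cover by blast
    ultimately have "v \<in> patch_ball A P j (Suc k)"
      using u by (auto simp: vectors_adjacent_def)
    then show False using v by blast
  qed
  have "orthogonal (A *v u) z" if "u \<in> patch_ball A P j k" for u
    using z gen[OF _ that]
    by (intro orthogonal_to_span[OF z]) (simp add: orthogonal_def inner_commute)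
  then have "orthogonal (A *v z) u" if "u \<in> patch_ball A P j k" for u
    using that A_sym[of u z] by (simp add: orthogonal_def inner_commute)
  then have "orthogonal (A *v z) x" by (intro orthogonal_to_span[OF x])
  then show ?thesis by (simp add: orthogonal_def inner_commute)
qed

end

section \<open>Measurements and admissible corrections\<close>

locale measured_energy_partition = energy_partition A E V P
  for A :: "real^'n^'n"
    and E :: "'e::finite \<Rightarrow> real^'n^'n"
    and V :: "(real^'n) set"
    and P :: "'m::finite \<Rightarrow> (real^'n) set" +
  fixes \<Phi> :: "real^'q^'n"
    and b :: "'q \<Rightarrow> 'm"
  assumes columns: "patchwise_orthonormal \<Phi> b P"
    and interior_positive: "\<And>j x. x \<in> complement_space P \<Phi> b j \<Longrightarrow> x \<noteq> 0 \<Longrightarrow>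
      0 < x \<bullet> (interior_energy E V (P j) *v x)"
begin

lemma column_in_span: "column i \<Phi> \<in> span (P (b i))"
  using columns by (simp add: patchwise_orthonormal_def)

lemma inner_column:
  assumes "P (b i) \<subseteq> S" "S \<subseteq> V"
  shows "column i \<Phi> \<bullet> basis_part S x = column i \<Phi> \<bullet> x"
proof -
  have "column i \<Phi> \<in> span S" using column_in_span assms(1) span_mono by blast
  then show ?thesis by (simp add: basis_part_self_adjoint basis_part_id[OF basis assms(2)])
qed

text \<open>Stated for arbitrary disjoint sets of basis vectors since it serves twice: for
  the orthogonality of different blocks of columns and for the cutting of corrections.\<close>

lemma inner_column_disjoint:
  assumes "P (b i) \<inter> S = {}" "S \<subseteq> V"
  shows "column i \<Phi> \<bullet> basis_part S x = 0"
proof -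
  have "basis_part S (column i \<Phi>) = basis_part (S \<inter> P (b i)) (column i \<Phi>)"
    using basis_part_basis_part[OF basis assms(2) patch_subset, of "b i" "column i \<Phi>"]
    by (simp add: basis_part_id[OF basis patch_subset column_in_span])
  also have "\<dots> = 0"
    using assms(1) by (simp add: Int_commute basis_part_def)
  finally show ?thesis by (simp add: basis_part_self_adjoint)
qed

lemma columns_orthonormal: "column i \<Phi> \<bullet> column i' \<Phi> = (if i = i' then 1 else 0)"
proof (cases "b i = b i'")
  case True
  then show ?thesis using columns by (simp add: patchwise_orthonormal_def)
next
  case False
  then have "column i \<Phi> \<bullet> basis_part (P (b i')) (column i' \<Phi>) = 0"
    by (intro inner_column_disjoint patch_disjoint patch_subset)
  then show ?thesis
    using False by (auto simp: basis_part_id[OF basis patch_subset column_in_span])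
qed

text \<open>The vectors that can be added to a feasible vector supported on \<open>S\<close> without violating the
  constraints. The approximators are energy-orthogonal to them, and on a single patch they form the
  complement space.\<close>

definition corrections :: "(real^'n) set \<Rightarrow> (real^'n) set" where
  "corrections S = {x \<in> span S. \<forall>i. column i \<Phi> \<bullet> x = 0}"

lemma subspace_corrections: "subspace (corrections S)"
  by (auto simp: subspace_def corrections_def inner_simps span_zero span_add span_scale)

lemma corrections_mono: "S \<subseteq> T \<Longrightarrow> corrections S \<subseteq> corrections T"
  unfolding corrections_def using span_mono by blast

lemma corrections_V: "x \<in> corrections V \<longleftrightarrow> (\<forall>i. column i \<Phi> \<bullet> x = 0)"
  using basis by (simp add: corrections_def orthonormal_basis_def)

lemma basis_part_corrections:
  assumes x: "x \<in> corrections V" and S: "patch_union S"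
  shows "basis_part S x \<in> corrections S"
proof -
  have "column i \<Phi> \<bullet> basis_part S x = 0" for i
  proof (cases "P (b i) \<subseteq> S")
    case True
    then show ?thesis
      using x S by (simp add: inner_column patch_union_def corrections_def)
  next
    case False
    then show ?thesis
      using S by (intro inner_column_disjoint) (auto simp: patch_union_def)
  qed
  then show ?thesis by (simp add: corrections_def basis_part_in_span)
qed

lemma complement_space_eq_corrections: "complement_space P \<Phi> b j = corrections (P j)"
proof (intro set_eqI iffI)
  fix x assume x: "x \<in> complement_space P \<Phi> b j"
  then have span: "x \<in> span (P j)" by (simp add: complement_space_def)
  have "column i \<Phi> \<bullet> x = 0" for i
  proof (cases "b i = j")
    case True
    then have "column i \<Phi> \<in> span (block_columns \<Phi> b j)"
      by (intro span_base) (auto simp: block_columns_def)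
    then show ?thesis
      using x by (simp add: complement_space_def orthogonal_comp_def orthogonal_def)
  next
    case False
    then have "column i \<Phi> \<bullet> basis_part (P j) x = 0"
      by (intro inner_column_disjoint patch_disjoint patch_subset)
    then show ?thesis by (simp add: basis_part_id[OF basis patch_subset span])
  qed
  then show "x \<in> corrections (P j)" using span by (simp add: corrections_def)
next
  fix x assume x: "x \<in> corrections (P j)"
  have "orthogonal y x" if "y \<in> span (block_columns \<Phi> b j)" for y
  proof -
    have "orthogonal x y"
      using x by (intro orthogonal_to_span[OF that])
        (auto simp: block_columns_def corrections_def orthogonal_def inner_commute)
    then show ?thesis by (simp add: orthogonal_commute)
  qed
  then show "x \<in> complement_space P \<Phi> b j"
    using x by (simp add: complement_space_def corrections_def orthogonal_comp_def)
qed

abbreviation alpha :: real where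
  "alpha \<equiv> partition_ratio E V P \<Phi> b"

lemma patch_ratio_le_alpha: "patch_ratio E V P \<Phi> b j \<le> alpha"
  unfolding partition_ratio_def by (intro Max_ge) auto

lemma quotient_le_patch_ratio:
  assumes "x \<in> corrections (P j)" "x \<noteq> 0"
  shows "(x \<bullet> (closed_energy E V (P j) *v x)) / (x \<bullet> (interior_energy E V (P j) *v x))
    \<le> patch_ratio E V P \<Phi> b j"
proof -
  have "corrections (P j) \<noteq> {0}" using assms by auto
  moreover have "bdd_above ((\<lambda>x. (x \<bullet> (closed_energy E V (P j) *v x)) /
      (x \<bullet> (interior_energy E V (P j) *v x))) ` (corrections (P j) - {0}))"
    using interior_positive
    by (intro form_ratio_bdd_above subspace_corrections) (simp add: complement_space_eq_corrections)
  then have "(x \<bullet> (closed_energy E V (P j) *v x)) / (x \<bullet> (interior_energy E V (P j) *v x))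
      \<le> (SUP x\<in>corrections (P j) - {0}.
        (x \<bullet> (closed_energy E V (P j) *v x)) / (x \<bullet> (interior_energy E V (P j) *v x)))"
    using assms by (intro cSUP_upper) simp_all
  ultimately show ?thesis by (simp add: patch_ratio_def complement_space_eq_corrections)
qed

lemma closed_le_alpha_interior:
  assumes "x \<in> corrections (P j)"
  shows "x \<bullet> (closed_energy E V (P j) *v x) \<le> alpha * (x \<bullet> (interior_energy E V (P j) *v x))"
proof (cases "x = 0")
  case False
  then have pos: "0 < x \<bullet> (interior_energy E V (P j) *v x)"
    using assms interior_positive by (simp add: complement_space_eq_corrections)
  have "(x \<bullet> (closed_energy E V (P j) *v x)) / (x \<bullet> (interior_energy E V (P j) *v x)) \<le> alpha"
    using quotient_le_patch_ratio[OF assms False] patch_ratio_le_alpha by (rule order_trans)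
  then show ?thesis using pos by (simp add: pos_divide_le_eq)
qed simp

lemma alpha_ge_1: "1 \<le> alpha"
proof -
  fix j :: 'm
  have "1 \<le> patch_ratio E V P \<Phi> b j"
  proof (cases "corrections (P j) = {0}")
    case True
    then show ?thesis by (simp add: patch_ratio_def complement_space_eq_corrections)
  next
    case False
    then obtain x where x: "x \<in> corrections (P j)" "x \<noteq> 0"
      using subspace_0[OF subspace_corrections] by blast
    then have "0 < x \<bullet> (interior_energy E V (P j) *v x)"
      using interior_positive by (simp add: complement_space_eq_corrections)
    then have "1 \<le> (x \<bullet> (closed_energy E V (P j) *v x)) / (x \<bullet> (interior_energy E V (P j) *v x))"
      using interior_le_closed[OF patch_subset] by (simp add: pos_le_divide_eq)
    then show ?thesis using quotient_le_patch_ratio[OF x] by (rule order_trans)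
  qed
  then show ?thesis using patch_ratio_le_alpha by (rule order_trans)
qed

section \<open>Exponential decay of the localisation error\<close>

text \<open>Cutting a vector to a union of patches can increase its energy, but only by the factor
  \<open>\<alpha>\<close>: the cut vector is bounded by the sum of its closed patch energies, each of these by \<open>\<alpha>\<close>
  times the interior energy of the same patch, and the interior energies of the uncut vector add up
  to at most its energy.\<close>

lemma restricted_energy_le:
  assumes f: "f \<in> corrections V" and S: "patch_union S"
  shows "basis_part S f \<bullet> (A *v basis_part S f) \<le> alpha * (f \<bullet> (A *v f))"
proof -
  let ?w = "basis_part S f"
  let ?C = "\<lambda>j. closed_energy E V (P j)"
  let ?I = "\<lambda>j. interior_energy E V (P j)"
  have S_sub: "S \<subseteq> V" using S by (simp add: patch_union_def)
  have int_nonneg: "0 \<le> x \<bullet> (?I j *v x)" for x j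
    unfolding interior_energy_form by (intro sum_nonneg) (simp add: energy_form_nonneg)
  have "?w \<bullet> (A *v ?w) \<le> (\<Sum>j\<in>UNIV. basis_part (P j) ?w \<bullet> (?C j *v basis_part (P j) ?w))"
    by (rule energy_le_closed_sum)
  also have "\<dots> \<le> (\<Sum>j\<in>UNIV. alpha * (basis_part (P j) f \<bullet> (?I j *v basis_part (P j) f)))"
  proof (intro sum_mono)
    fix j
    have patch: "basis_part (P j) ?w = basis_part (P j \<inter> S) f"
      by (rule basis_part_basis_part[OF basis patch_subset S_sub])
    have "basis_part (P j) f \<in> corrections (P j)"
      using f patch_union_Union[of "{j}"] by (intro basis_part_corrections) simp_all
    then have bound: "basis_part (P j) f \<bullet> (?C j *v basis_part (P j) f)
        \<le> alpha * (basis_part (P j) f \<bullet> (?I j *v basis_part (P j) f))"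
      by (rule closed_le_alpha_interior)
    show "basis_part (P j) ?w \<bullet> (?C j *v basis_part (P j) ?w)
        \<le> alpha * (basis_part (P j) f \<bullet> (?I j *v basis_part (P j) f))"
    proof (cases "P j \<subseteq> S")
      case True
      then show ?thesis using bound patch by (simp add: Int_absorb2)
    next
      case False
      then have "basis_part (P j) ?w = 0"
        using S patch by (auto simp: patch_union_def basis_part_def)
      then show ?thesis using alpha_ge_1 int_nonneg by simp
    qed
  qed
  also have "\<dots> = alpha * (\<Sum>j\<in>UNIV. basis_part (P j) f \<bullet> (?I j *v basis_part (P j) f))"
    by (simp add: sum_distrib_left)
  also have "\<dots> \<le> alpha * (f \<bullet> (A *v f))"
    using alpha_ge_1 by (intro mult_left_mono interior_sum_le_energy) simp
  finally show ?thesis .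
qed

text \<open>One step of the decay, for nested unions of patches \<open>S \<subseteq> T\<close>. Here \<open>f\<close> is the error of the
  smaller problem and \<open>g\<close> that of the larger one. The residual \<open>A f\<close> is invisible to corrections
  inside \<open>S\<close> and outside \<open>T\<close>, so the whole energy of \<open>f\<close> is already seen by its part \<open>w\<close> on the layer
  \<open>T - S\<close>. That part is an admissible correction on \<open>T\<close> of energy at most \<open>\<alpha>\<close> times that of \<open>f\<close>,
  so the optimal correction \<open>f - g\<close> must remove at least the fraction \<open>1 / \<alpha>\<close> of the energy.\<close>

lemma error_contraction:
  assumes S: "patch_union S" and T: "patch_union T" and ST: "S \<subseteq> T"
    and f: "f \<in> corrections V"
    and f_inner: "\<And>z. z \<in> corrections S \<Longrightarrow> f \<bullet> (A *v z) = 0"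
    and f_outer: "\<And>z. z \<in> corrections (V - T) \<Longrightarrow> f \<bullet> (A *v z) = 0"
    and fg: "f - g \<in> corrections T"
    and g: "\<And>z. z \<in> corrections T \<Longrightarrow> g \<bullet> (A *v z) = 0"
  shows "g \<bullet> (A *v g) \<le> (alpha - 1) / alpha * (f \<bullet> (A *v f))"
proof -
  define w where "w = basis_part (T - S) f"
  define d where "d = f - g"
  define F where "F = f \<bullet> (A *v f)"
  define D where "D = d \<bullet> (A *v d)"
  define G where "G = g \<bullet> (A *v g)"
  have TV: "T \<subseteq> V" using T by (simp add: patch_union_def)
  have D0: "0 \<le> D" by (simp add: D_def A_nonneg)
  have F0: "0 \<le> F" by (simp add: F_def A_nonneg)
  have T_split: "basis_part T f = basis_part S f + w"
  proof -
    have "T = S \<union> (T - S)" using ST by blast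
    then show ?thesis
      unfolding w_def using basis_part_disjoint_union[of S "T - S" f]
        finite_subset[OF TV finite_V] finite_subset[OF ST] by fastforce
  qed
  have "f = basis_part S f + w + basis_part (V - T) f"
    using basis_part_complement[OF TV, of f] T_split by simp
  then have "f \<bullet> (A *v f) = f \<bullet> (A *v (basis_part S f + w + basis_part (V - T) f))"
    by simp
  also have "\<dots> = f \<bullet> (A *v basis_part S f) + f \<bullet> (A *v w) + f \<bullet> (A *v basis_part (V - T) f)"
    by (simp add: matrix_vector_right_distrib inner_add_right)
  also have "\<dots> = f \<bullet> (A *v w)"
    using f_inner[OF basis_part_corrections[OF f S]]
      f_outer[OF basis_part_corrections[OF f patch_union_Diff[OF patch_union_V T]]] by simp
  finally have Fw: "F = f \<bullet> (A *v w)" by (simp add: F_def)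
  have layer: "patch_union (T - S)" by (rule patch_union_Diff[OF T S])
  have w: "w \<in> corrections T"
    using basis_part_corrections[OF f layer] corrections_mono[of "T - S" T] by (auto simp: w_def)
  have "F = d \<bullet> (A *v w)"
    using g[OF w] Fw by (simp add: d_def inner_diff_left)
  then have "F\<^sup>2 \<le> D * (w \<bullet> (A *v w))"
    using psd_cauchy_schwarz[OF pd_imp_psd[OF pd], of d w] by (simp add: D_def)
  also have "\<dots> \<le> D * (alpha * F)"
    unfolding F_def w_def by (intro mult_left_mono restricted_energy_le f layer D0)
  finally have "F * F \<le> (alpha * D) * F" by (simp add: power2_eq_square mult_ac)
  then have FD: "F \<le> alpha * D"
    using F0 D0 alpha_ge_1 by (cases "F = 0") simp_all
  have "F = D + G"
  proof -
    have "f = d + g" by (simp add: d_def)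
    moreover have "d \<bullet> (A *v g) = 0" using g[OF fg] A_sym[of d g] by (simp add: d_def)
    ultimately show ?thesis
      using quadratic_form_add[of A d g] pd by (simp add: F_def D_def G_def symmetric_pd_def)
  qed
  then have "alpha * G \<le> (alpha - 1) * F" using FD by (simp add: algebra_simps)
  then show ?thesis using alpha_ge_1 by (simp add: F_def G_def field_simps)
qed

text \<open>Feasible vectors form the translate of the corrections by the column itself. The
  energy projection gives a minimiser, and the Pythagorean identity shows that it is the only one,
  so the choice hidden in \<^const>\<open>arg_min_on\<close> must return it.\<close>

lemma local_approximator_properties:
  fixes i :: 'q and k :: nat
  defines "x \<equiv> local_approximator A P \<Phi> b k i"
  shows "x \<in> span (patch_ball A P (b i) k)"
    and "column i' \<Phi> \<bullet> x = (if i' = i then 1 else 0)"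
    and "z \<in> corrections (patch_ball A P (b i) k) \<Longrightarrow> x \<bullet> (A *v z) = 0"
proof -
  let ?S = "patch_ball A P (b i) k"
  let ?W = "corrections ?S"
  define X where "X = {x \<in> span ?S. \<forall>i'. column i' \<Phi> \<bullet> x = (if i' = i then 1 else 0)}"
  have col: "column i \<Phi> \<in> X"
    using column_in_span[of i] span_mono[OF patch_subset_patch_ball]
    by (auto simp: X_def columns_orthonormal)
  obtain w where w: "w \<in> ?W" "\<And>z. z \<in> ?W \<Longrightarrow> (column i \<Phi> - w) \<bullet> (A *v z) = 0"
    using form_projection_exists[OF subspace_corrections, of ?S A "column i \<Phi>"] pd
    unfolding symmetric_pd_def by metis
  define m where "m = column i \<Phi> - w"
  have mX: "m \<in> X"
    using col w(1) by (auto simp: X_def m_def corrections_def inner_diff_right span_diff)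
  have energy: "y \<bullet> (A *v y) = m \<bullet> (A *v m) + (y - m) \<bullet> (A *v (y - m))" if "y \<in> X" for y
  proof -
    have "y - m \<in> ?W"
      using that mX by (auto simp: X_def corrections_def inner_diff_right span_diff)
    then have "m \<bullet> (A *v (y - m)) = 0" using w(2) by (simp add: m_def)
    then show ?thesis
      using quadratic_form_add[of A m "y - m"] pd by (simp add: symmetric_pd_def)
  qed
  have min: "is_arg_min (energy_norm A) (\<lambda>x. x \<in> X) m"
    unfolding is_arg_min_linorder
  proof (intro conjI allI impI)
    show "energy_norm A m \<le> energy_norm A y" if "y \<in> X" for y
      unfolding energy_norm_def using energy[OF that] A_nonneg[of "y - m"] by simp
  qed (rule mX)
  have "is_arg_min (energy_norm A) (\<lambda>x. x \<in> X) x"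
    unfolding x_def local_approximator_def X_def[symmetric] arg_min_on_def arg_min_def
    by (rule someI[of "is_arg_min (energy_norm A) (\<lambda>x. x \<in> X)", OF min])
  then have xX: "x \<in> X" and "energy_norm A x \<le> energy_norm A m"
    using mX by (auto simp: is_arg_min_linorder)
  then have "(x - m) \<bullet> (A *v (x - m)) \<le> 0"
    using energy[OF xX] by (simp add: energy_norm_def)
  then have "x = m" using pd by (metis symmetric_pd_def not_le right_minus_eq)
  then show "z \<in> ?W \<Longrightarrow> x \<bullet> (A *v z) = 0" using w(2) by (simp add: m_def)
  show "x \<in> span ?S" "column i' \<Phi> \<bullet> x = (if i' = i then 1 else 0)"
    using xX by (simp_all add: X_def)
qed

lemma columns_independent:
  assumes "\<Phi> *v c = 0"
  shows "c = 0"
proof -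
  have "\<Phi> *v c = (\<Sum>i\<in>UNIV. (c $ i) *\<^sub>R column i \<Phi>)"
    by (simp add: matrix_mult_sum scalar_mult_eq_scaleR)
  then have "(\<Sum>i\<in>UNIV. c $ i * (column l \<Phi> \<bullet> column i \<Phi>)) = column l \<Phi> \<bullet> 0" for l
    using assms by (metis (no_types, lifting) inner_scaleR_right inner_sum_right sum.cong)
  then show ?thesis
    by (simp add: vec_eq_iff columns_orthonormal if_distrib cong: if_cong)
qed

lemma Psi_properties:
  shows "column i' \<Phi> \<bullet> column i (Psi_matrix A \<Phi>) = (if i' = i then 1 else 0)"
    and "z \<in> corrections V \<Longrightarrow> column i (Psi_matrix A \<Phi>) \<bullet> (A *v z) = 0"
proof -
  show "column i' \<Phi> \<bullet> column i (Psi_matrix A \<Phi>) = (if i' = i then 1 else 0)"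
    using pd columns_independent by (rule Psi_column(1))
  show "z \<in> corrections V \<Longrightarrow> column i (Psi_matrix A \<Phi>) \<bullet> (A *v z) = 0"
    using pd columns_independent by (rule Psi_column(2)) (simp_all add: corrections_def)
qed

abbreviation localisation_error :: "nat \<Rightarrow> 'q \<Rightarrow> real^'n" where
  "localisation_error k i \<equiv> local_approximator A P \<Phi> b k i - column i (Psi_matrix A \<Phi>)"

text \<open>The difference inherits the orthogonality of the local approximator, because the exact basis
  function is orthogonal to corrections on any set.\<close>

lemma localisation_error_orthogonal:
  assumes "z \<in> corrections (patch_ball A P (b i) k)"
  shows "localisation_error k i \<bullet> (A *v z) = 0"
proof -
  have "z \<in> corrections V"
    using assms corrections_mono patch_ball_patch_union by (auto simp: patch_union_def)
  then show ?thesis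
    using local_approximator_properties(3)[OF assms] Psi_properties(2) by (simp add: inner_diff_left)
qed

lemma localisation_error_in_corrections: "localisation_error k i \<in> corrections V"
  by (simp add: corrections_V inner_diff_right local_approximator_properties(2) Psi_properties(1))

lemma localisation_error_Suc:
  "localisation_error (Suc k) i \<bullet> (A *v localisation_error (Suc k) i)
    \<le> (alpha - 1) / alpha * (localisation_error k i \<bullet> (A *v localisation_error k i))"
proof (rule error_contraction[where S = "patch_ball A P (b i) k"
      and T = "patch_ball A P (b i) (Suc k)"])
  show "localisation_error k i - localisation_error (Suc k) i
      \<in> corrections (patch_ball A P (b i) (Suc k))"
    using span_mono[OF patch_ball_Suc_subset] local_approximator_properties(1,2)[where i = i]
    by (auto simp: corrections_def inner_diff_right simp del: patch_ball.simps intro!: span_diff)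
next
  fix z assume z: "z \<in> corrections (V - patch_ball A P (b i) (Suc k))"
  then have "z \<in> corrections V" using corrections_mono[of _ V] by blast
  moreover have "local_approximator A P \<Phi> b k i \<bullet> (A *v z) = 0"
    using z patch_ball_Suc_separates[OF local_approximator_properties(1)]
    unfolding corrections_def by blast
  ultimately show "localisation_error k i \<bullet> (A *v z) = 0"
    using Psi_properties(2) by (simp add: inner_diff_left)
qed (use patch_ball_patch_union patch_ball_Suc_subset localisation_error_orthogonal
    localisation_error_in_corrections in blast)+

lemma localisation_error_decay:
  "localisation_error k i \<bullet> (A *v localisation_error k i)
    \<le> ((alpha - 1) / alpha) ^ k * (localisation_error 0 i \<bullet> (A *v localisation_error 0 i))"
proof (induction k)
  case (Suc k)
  have "localisation_error (Suc k) i \<bullet> (A *v localisation_error (Suc k) i)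
      \<le> (alpha - 1) / alpha * (localisation_error k i \<bullet> (A *v localisation_error k i))"
    by (rule localisation_error_Suc)
  also have "\<dots> \<le> (alpha - 1) / alpha *
      (((alpha - 1) / alpha) ^ k * (localisation_error 0 i \<bullet> (A *v localisation_error 0 i)))"
    using alpha_ge_1 by (intro mult_left_mono Suc.IH) simp
  finally show ?case by simp
qed simp

section \<open>The error on a single patch\<close>

text \<open>The bound holds for each competitor in the supremum once the supremum is known to be
  finite. Writing a competitor as \<open>C u\<close>, with \<open>C\<close> the closed energy, turns its quotient into the
  quotient of the forms of \<open>C\<^sup>2\<close> and \<open>C\<close> at \<open>u\<close>, which is bounded on the span of the patch.\<close>

lemma condition_factor_upper:
  assumes "y \<in> span (block_columns \<Phi> b j)" "x \<in> span (P j)"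
    and "closed_energy E V (P j) *v x = y" "x \<noteq> 0"
  shows "y \<bullet> y \<le> condition_factor E V P \<Phi> b j * (x \<bullet> y)"
proof -
  let ?C = "closed_energy E V (P j)"
  let ?inv = "the_inv_into (span (P j)) ((*v) ?C)"
  let ?q = "\<lambda>y. (y \<bullet> y) / (y \<bullet> ?inv y)"
  have sub: "span (block_columns \<Phi> b j) \<subseteq> span (P j)"
    using column_in_span by (intro span_minimal) (auto simp: block_columns_def)
  have "bdd_above ((\<lambda>x. (x \<bullet> ((?C ** ?C) *v x)) / (x \<bullet> (?C *v x))) ` (span (P j) - {0}))"
    using closed_energy_positive by (intro form_ratio_bdd_above) simp_all
  moreover have "?q ` (span (block_columns \<Phi> b j) - {0})
      \<subseteq> (\<lambda>x. (x \<bullet> ((?C ** ?C) *v x)) / (x \<bullet> (?C *v x))) ` (span (P j) - {0})"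
  proof (rule image_subsetI)
    fix y assume y: "y \<in> span (block_columns \<Phi> b j) - {0}"
    then have inv: "?inv y \<in> span (P j)" "?C *v ?inv y = y"
      using sub by (auto intro: closed_energy_inverse)
    then have "?inv y \<noteq> 0" using y by auto
    moreover have "?q y = (?inv y \<bullet> ((?C ** ?C) *v ?inv y)) / (?inv y \<bullet> (?C *v ?inv y))"
      using inv(2) closed_energy_sym[of "?inv y" j y] by (simp add: matrix_vector_mul_assoc[symmetric] inner_commute)
    ultimately show "?q y \<in> (\<lambda>x. (x \<bullet> ((?C ** ?C) *v x)) / (x \<bullet> (?C *v x))) ` (span (P j) - {0})"
      using inv(1) by blast
  qed
  ultimately have bdd: "bdd_above (?q ` (span (block_columns \<Phi> b j) - {0}))"
    by (rule bdd_above_mono)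
  have pos: "0 < x \<bullet> y"
    using closed_energy_positive[OF assms(2,4)] assms(3) by simp
  have inv: "?inv y = x"
  proof -
    have y: "y \<in> span (P j)" using assms(1) sub by blast
    have "?C *v (?inv y - x) = 0"
      using closed_energy_inverse(2)[OF y] assms(3) by (simp add: matrix_vector_mult_diff_distrib)
    moreover have "?inv y - x \<in> span (P j)"
      using closed_energy_inverse(1)[OF y] assms(2) by (rule span_diff)
    ultimately show ?thesis
      using closed_energy_positive[of "?inv y - x" j] by fastforce
  qed
  have "?q y \<le> condition_factor E V P \<Phi> b j"
    unfolding condition_factor_def using assms(1) pos by (intro cSUP_upper bdd) auto
  then show ?thesis using pos by (simp add: inv inner_commute[of y x] pos_divide_le_eq)
qed

text \<open>A competitor for the energy minimisation on the single patch is the feasible vector \<open>u\<close> of least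
  closed energy. Minimality makes \<open>y = C u\<close>, with \<open>C\<close> the closed energy, orthogonal to all corrections,
  so \<open>y\<close> lies in the span of the columns of the patch and is a competitor in the condition factor
  \<open>\<delta>\<close>. As \<open>u\<^sup>T y\<close> is the coefficient of \<open>y\<close> at a unit column,
  \<open>(u\<^sup>T y)\<^sup>2 \<le> y\<^sup>T y \<le> \<delta> (u\<^sup>T y)\<close>, and the energy of the local approximator is at most
  that of \<open>u\<close>, hence at most \<open>u\<^sup>T C u = u\<^sup>T y \<le> \<delta>\<close>.\<close>

lemma local_energy_le_condition_factor:
  fixes i :: 'q
  defines "x \<equiv> local_approximator A P \<Phi> b 0 i"
  shows "x \<bullet> (A *v x) \<le> condition_factor E V P \<Phi> b (b i)"
proof -
  let ?j = "b i"
  let ?C = "closed_energy E V (P ?j)"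
  let ?W = "corrections (P ?j)"
  obtain w where w: "w \<in> ?W" "\<And>z. z \<in> ?W \<Longrightarrow> (column i \<Phi> - w) \<bullet> (?C *v z) = 0"
    using form_projection_exists[OF subspace_corrections, of "P ?j" ?C "column i \<Phi>"]
      closed_energy_positive unfolding corrections_def by blast
  define u where "u = column i \<Phi> - w"
  define y where "y = ?C *v u"
  have u_span: "u \<in> span (P ?j)"
    using w(1) column_in_span by (auto simp: u_def corrections_def intro: span_diff)
  have u_constr: "column i' \<Phi> \<bullet> u = (if i' = i then 1 else 0)" for i'
    using w(1) by (simp add: u_def corrections_def inner_diff_right columns_orthonormal)
  have y_span: "y \<in> span (P ?j)"
    unfolding y_def by (rule closed_energy_range[OF patch_subset])
  have y_orth: "y \<bullet> z = 0" if "z \<in> ?W" for z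
  proof -
    have "u \<bullet> (?C *v z) = z \<bullet> (?C *v u)" by (rule closed_energy_sym)
    then show ?thesis using w(2)[OF that] by (simp add: u_def y_def inner_commute)
  qed
  \<comment> \<open>The orthogonal projection of \<open>y\<close> to the span of its block; it will turn out to be \<open>y\<close> itself.\<close>
  define p where "p = (\<Sum>l | b l = ?j. (column l \<Phi> \<bullet> y) *\<^sub>R column l \<Phi>)"
  have p_block: "p \<in> span (block_columns \<Phi> b ?j)"
    unfolding p_def by (intro span_sum span_scale span_base) (auto simp: block_columns_def)
  have p_span: "p \<in> span (P ?j)"
    unfolding p_def using column_in_span by (intro span_sum span_scale) (metis mem_Collect_eq)
  have inner_p: "column l \<Phi> \<bullet> p = (if b l = ?j then column l \<Phi> \<bullet> y else 0)" for l
  proof -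
    have "column l \<Phi> \<bullet> p = (\<Sum>i' | b i' = ?j. if i' = l then column i' \<Phi> \<bullet> y else 0)"
      unfolding p_def inner_sum_right by (intro sum.cong) (auto simp: columns_orthonormal)
    then show ?thesis by (simp add: sum.delta)
  qed
  have "column l \<Phi> \<bullet> (y - p) = 0" for l
  proof (cases "b l = ?j")
    case True
    then show ?thesis by (simp add: inner_diff_right inner_p)
  next
    case False
    have "column l \<Phi> \<bullet> basis_part (P ?j) y = 0"
      using False by (intro inner_column_disjoint patch_disjoint patch_subset)
    then show ?thesis
      using False by (simp add: inner_diff_right inner_p basis_part_id[OF basis patch_subset y_span])
  qed
  then have yp: "y - p \<in> ?W"
    using y_span p_span by (simp add: corrections_def span_diff)
  have "y = p"
  proof -
    have "p \<bullet> (y - p) = 0"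
      unfolding p_def inner_sum_left
      using yp by (intro sum.neutral) (simp add: corrections_def p_def)
    then have "(y - p) \<bullet> (y - p) = 0" using y_orth[OF yp] by (simp add: inner_diff_left)
    then show ?thesis by simp
  qed
  then have y_block: "y \<in> span (block_columns \<Phi> b ?j)" using p_block by simp
  have uy: "u \<bullet> y = column i \<Phi> \<bullet> y"
    using y_orth[OF w(1)] by (simp add: u_def inner_diff_left inner_commute[of w y])
  have u0: "u \<noteq> 0" using u_constr[of i] by auto
  have pos: "0 < u \<bullet> y" using closed_energy_positive[OF u_span u0] by (simp add: y_def)
  have "(u \<bullet> y)\<^sup>2 \<le> y \<bullet> y"
    using Cauchy_Schwarz_ineq[of "column i \<Phi>" y] uy by (simp add: columns_orthonormal)
  also have "\<dots> \<le> condition_factor E V P \<Phi> b ?j * (u \<bullet> y)"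
    using y_block u_span u0 by (intro condition_factor_upper) (simp_all add: y_def)
  finally have u_bound: "u \<bullet> y \<le> condition_factor E V P \<Phi> b ?j"
    using pos by (simp add: power2_eq_square)
  have "x \<bullet> (A *v x) \<le> u \<bullet> (A *v u)"
  proof -
    have x: "x \<in> span (P ?j)" "\<And>i'. column i' \<Phi> \<bullet> x = (if i' = i then 1 else 0)"
      "\<And>z. z \<in> ?W \<Longrightarrow> x \<bullet> (A *v z) = 0"
      using local_approximator_properties[where k = 0 and i = i] by (simp_all add: x_def)
    have "u - x \<in> ?W"
      using x(1,2) u_span u_constr by (simp add: corrections_def inner_diff_right span_diff)
    then have "x \<bullet> (A *v (u - x)) = 0" by (rule x(3))
    then have "u \<bullet> (A *v u) = x \<bullet> (A *v x) + (u - x) \<bullet> (A *v (u - x))"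
      using quadratic_form_add[of A x "u - x"] pd by (simp add: symmetric_pd_def)
    then show ?thesis using A_nonneg by simp
  qed
  also have "\<dots> \<le> u \<bullet> y" unfolding y_def by (rule energy_le_closed[OF u_span])
  finally show ?thesis using u_bound by simp
qed

text \<open>The exact basis function is energy-orthogonal to the error, so the error has at most the
  energy of the local approximator.\<close>

lemma initial_error_le_condition_factor:
  "localisation_error 0 i \<bullet> (A *v localisation_error 0 i) \<le> condition_factor E V P \<Phi> b (b i)"
proof -
  let ?\<psi> = "column i (Psi_matrix A \<Phi>)"
  let ?x = "local_approximator A P \<Phi> b 0 i"
  have "?\<psi> \<bullet> (A *v localisation_error 0 i) = 0"
    by (rule Psi_properties(2)[OF localisation_error_in_corrections])
  then have "?x \<bullet> (A *v ?x) = ?\<psi> \<bullet> (A *v ?\<psi>)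
      + localisation_error 0 i \<bullet> (A *v localisation_error 0 i)"
    using quadratic_form_add[of A ?\<psi> "localisation_error 0 i"] pd by (simp add: symmetric_pd_def)
  then have "localisation_error 0 i \<bullet> (A *v localisation_error 0 i) \<le> ?x \<bullet> (A *v ?x)"
    using A_nonneg by simp
  also have "\<dots> \<le> condition_factor E V P \<Phi> b (b i)" by (rule local_energy_le_condition_factor)
  finally show ?thesis .
qed

end

section \<open>Localisation of the energy-minimising basis\<close>

theorem theorem3p18:
  fixes A :: "real^'n^'n"
    and E :: "'e::finite \<Rightarrow> real^'n^'n"
    and V :: "(real^'n) set"
    and P :: "'m::finite \<Rightarrow> (real^'n) set"
    and \<Phi> :: "real^'q^'n"
    and b :: "'q \<Rightarrow> 'm"
    and i :: 'q
    and k :: nat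
  assumes "symmetric_pd A"
    and "energy_decomposition A E"
    and "orthonormal_basis V"
    and "patch_partition V P"
    and "patchwise_orthonormal \<Phi> b P"
    and "\<forall>j. \<forall>x\<in>complement_space P \<Phi> b j.
           x \<noteq> 0 \<longrightarrow> 0 < x \<bullet> (interior_energy E V (P j) *v x)"
  defines "\<psi> \<equiv> column i (Psi_matrix A \<Phi>)"
    and "\<psi>loc \<equiv> (\<lambda>k'. local_approximator A P \<Phi> b k' i)"
    and "\<alpha> \<equiv> partition_ratio E V P \<Phi> b"
  shows "(energy_norm A (\<psi>loc k - \<psi>))\<^sup>2
           \<le> ((\<alpha> - 1) / \<alpha>) ^ k * (energy_norm A (\<psi>loc 0 - \<psi>))\<^sup>2
       \<and> ((\<alpha> - 1) / \<alpha>) ^ k * (energy_norm A (\<psi>loc 0 - \<psi>))\<^sup>2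
           \<le> ((\<alpha> - 1) / \<alpha>) ^ k * condition_factor E V P \<Phi> b (b i)"
proof -
  interpret measured_energy_partition A E V P \<Phi> b
    by unfold_locales (use assms(1-6) in blast)+
  have norm: "(energy_norm A x)\<^sup>2 = x \<bullet> (A *v x)" for x
    by (rule energy_norm_squared[OF pd_imp_psd[OF assms(1)]])
  have "0 \<le> (\<alpha> - 1) / \<alpha>" unfolding \<alpha>_def using alpha_ge_1 by simp
  then have "((\<alpha> - 1) / \<alpha>) ^ k * (localisation_error 0 i \<bullet> (A *v localisation_error 0 i))
      \<le> ((\<alpha> - 1) / \<alpha>) ^ k * condition_factor E V P \<Phi> b (b i)"
    by (intro mult_left_mono initial_error_le_condition_factor) simp
  then show ?thesis
    unfolding norm \<psi>_def \<psi>loc_def \<alpha>_def using localisation_error_decay by blast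
qed

end
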